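(* Let $q>1$, $1<s<q'$, $\alpha>-1$, $u\in H(\mathbb{B})$, let $\varphi:\mathbb{B}\to\mathbb{B}$ be a holomorphic self-mapping, and let $\omega$ be a weight with $\omega^{s'}\in\mathcal{B}^{\alpha,q}_{u,\varphi}$, where $q'$ and $s'$ are the conjugate exponents of $q$ and $s$. Suppose further that $W_{u,\varphi}:A^q_\alpha(\mathbb{B})\to A^q_\alpha(\mathbb{B})$ is bounded. Then there is a constant $C>0$, independent of $f$ and of the weight $\omega$, such that for all $f\in A^q_\alpha(\mathbb{B})$, $$\int_{\mathbb{B}}|u(z)|^q|f(\varphi(z))|^q\omega(z)\,dV_\alpha(z)\le C\,\left[\omega^{s'}\right]_{\mathcal{B}^{\alpha,q}_{u,\varphi}}^{\frac1{s'}}\|f\|_{A^q_\alpha(\mathbb{B})}^q.$$ In particular, the measure $\mu_{u,\varphi,q,\omega,\alpha}$ on $\mathbb{B}$ defined by $$\int_{\mathbb{B}}g\,d\mu_{u,\varphi,q,\omega,\alpha}=\int_{\mathbb{B}}|u(z)|^q\,g(\varphi(z))\,\omega(z)\,dV_\alpha(z),\qquad g\text{ measurable},$$ is a $1$-Carleson measure.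
   Context: $\mathbb{B}$ is the open unit ball of $\mathbb{C}^n$ and $H(\mathbb{B})$ the holomorphic functions on $\mathbb{B}$. For $\alpha>-1$, $dV_\alpha(z)=c_\alpha(1-|z|^2)^\alpha dV(z)$, where $dV$ is Lebesgue measure and $c_\alpha$ makes $V_\alpha$ a probability measure on $\mathbb{B}$. For $p\ge1$, $A^p_\alpha(\mathbb{B})$ is the space of $f\in H(\mathbb{B})$ with $\|f\|_{A^p_\alpha(\mathbb{B})}^p=\int_{\mathbb{B}}|f|^p\,dV_\alpha<\infty$. The weighted composition operator is $W_{u,\varphi}f(z)=u(z)f(\varphi(z))$. A weight is a nonnegative measurable function on $\mathbb{B}$ that is positive on a set of positive measure. Given $\alpha>-1$, $q>1$, $u\in H(\mathbb{B})$ and $\varphi:\mathbb{B}\to\mathbb{B}$, the class $\mathcal{B}^{\alpha,q}_{u,\varphi}$ consists of all weights $\omega$ on $\mathbb{B}$ with $$[\omega]_{\mathcal{B}^{\alpha,q}_{u,\varphi}}:=\sup_{\zeta\in\mathbb{B}}\int_{\mathbb{B}}\frac{|u(z)|^q\omega(z)}{|1-\langle\zeta,\varphi(z)\rangle|^{\alpha+n+1}}\,dV_\alpha(z)<\infty,$$ where $\langle\cdot,\cdot\rangle$ is the standard Hermitian inner product on $\mathbb{C}^n$. For $z\in\mathbb{B}\setminus\{0\}$, the Carleson tent over $z$ is $T_z=\{w\in\mathbb{B}:|1-\langle z/|z|,w\rangle|<1-|z|\}$, and $T_0=\mathbb{B}$. A measure $\mu$ on $\mathbb{B}$ is a $1$-Carleson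 measure (with respect to $V_\alpha$) if $\sup_{z\in\mathbb{B}}\mu(T_z)/V_\alpha(T_z)<\infty$. *)

theory Defs
  imports "HOL-Analysis.Analysis"
begin

text \<open>\<open>\<complex>\<^sup>n\<close> is rendered as \<open>complex ^ 'n\<close> with \<open>n = CARD('n)\<close>; its library norm is the Euclidean
  one. Functions on the unit ball are total functions of which only the values on \<open>ball 0 1\<close>
  matter.\<close>

definition herm :: "complex ^ 'n \<Rightarrow> complex ^ 'n \<Rightarrow> complex" where
  "herm z w = (\<Sum>i\<in>UNIV. z $ i * cnj (w $ i))"

text \<open>Holomorphy in several variables, for open \<open>S\<close>: the (real) Frechet derivative exists at every
  point of \<open>S\<close> and is complex linear.\<close>

definition holo_on :: "(complex ^ 'n \<Rightarrow> complex) \<Rightarrow> (complex ^ 'n) set \<Rightarrow> bool" where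
  "holo_on f S \<longleftrightarrow>
     (\<forall>z\<in>S. \<exists>D. (f has_derivative D) (at z) \<and> (\<forall>c v. D (c *s v) = c * D v))"

definition holo_self_map :: "(complex ^ 'n \<Rightarrow> complex ^ 'n) \<Rightarrow> bool" where
  "holo_self_map \<phi> \<longleftrightarrow>
     \<phi> ` ball 0 1 \<subseteq> ball 0 1 \<and> (\<forall>i. holo_on (\<lambda>z. \<phi> z $ i) (ball 0 1))"

text \<open>The normalising constant is the reciprocal of the total mass, which is finite and positive
  for \<open>\<alpha> > -1\<close>.\<close>

definition bergman_const :: "'n::finite itself \<Rightarrow> real \<Rightarrow> real" where
  "bergman_const _ \<alpha> =
     1 / (LINT z|lebesgue_on (ball (0 :: complex ^ 'n) 1). (1 - (norm z)\<^sup>2) powr \<alpha>)"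

definition bergman_measure :: "real \<Rightarrow> (complex ^ 'n) measure" where
  "bergman_measure \<alpha> =
     density (lebesgue_on (ball 0 1))
       (\<lambda>z. ennreal (bergman_const TYPE('n) \<alpha> * (1 - (norm z)\<^sup>2) powr \<alpha>))"

definition bergman_space :: "real \<Rightarrow> real \<Rightarrow> (complex ^ 'n \<Rightarrow> complex) set" where
  "bergman_space \<alpha> p =
     {f. holo_on f (ball 0 1) \<and> integrable (bergman_measure \<alpha>) (\<lambda>z. norm (f z) powr p)}"

definition bergman_norm :: "real \<Rightarrow> real \<Rightarrow> (complex ^ 'n \<Rightarrow> complex) \<Rightarrow> real" where
  "bergman_norm \<alpha> p f = (LINT z|bergman_measure \<alpha>. norm (f z) powr p) powr (1 / p)"

definition weighted_comp ::
    "(complex ^ 'n \<Rightarrow> complex) \<Rightarrow> (complex ^ 'n \<Rightarrow> complex ^ 'n) \<Rightarrow>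
     (complex ^ 'n \<Rightarrow> complex) \<Rightarrow> complex ^ 'n \<Rightarrow> complex" where
  "weighted_comp u \<phi> f = (\<lambda>z. u z * f (\<phi> z))"

definition bergman_bounded ::
    "real \<Rightarrow> real \<Rightarrow> ((complex ^ 'n \<Rightarrow> complex) \<Rightarrow> (complex ^ 'n \<Rightarrow> complex)) \<Rightarrow> bool" where
  "bergman_bounded \<alpha> p T \<longleftrightarrow>
     (\<forall>f\<in>bergman_space \<alpha> p. T f \<in> bergman_space \<alpha> p) \<and>
     (\<exists>K. \<forall>f\<in>bergman_space \<alpha> p. bergman_norm \<alpha> p (T f) \<le> K * bergman_norm \<alpha> p f)"

definition conj_exponent :: "real \<Rightarrow> real" where
  "conj_exponent p = p / (p - 1)"

definition weight :: "(complex ^ 'n \<Rightarrow> real) \<Rightarrow> bool" where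
  "weight \<omega> \<longleftrightarrow>
     \<omega> \<in> borel_measurable (lebesgue_on (ball 0 1)) \<and>
     (\<forall>z\<in>ball 0 1. 0 \<le> \<omega> z) \<and>
     emeasure (lebesgue_on (ball 0 1)) {z \<in> ball 0 1. 0 < \<omega> z} > 0"

definition weight_const ::
    "real \<Rightarrow> real \<Rightarrow> (complex ^ 'n \<Rightarrow> complex) \<Rightarrow> (complex ^ 'n \<Rightarrow> complex ^ 'n) \<Rightarrow>
     (complex ^ 'n \<Rightarrow> real) \<Rightarrow> ennreal" where
  "weight_const \<alpha> q u \<phi> \<omega> =
     (SUP \<zeta>\<in>ball 0 1. \<integral>\<^sup>+ z. ennreal (norm (u z) powr q * \<omega> z /
        norm (1 - herm \<zeta> (\<phi> z)) powr (\<alpha> + real CARD('n) + 1)) \<partial>bergman_measure \<alpha>)"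

definition weight_class ::
    "real \<Rightarrow> real \<Rightarrow> (complex ^ 'n \<Rightarrow> complex) \<Rightarrow> (complex ^ 'n \<Rightarrow> complex ^ 'n) \<Rightarrow>
     (complex ^ 'n \<Rightarrow> real) set" where
  "weight_class \<alpha> q u \<phi> = {\<omega>. weight \<omega> \<and> weight_const \<alpha> q u \<phi> \<omega> < \<infinity>}"

definition carleson_tent :: "complex ^ 'n \<Rightarrow> (complex ^ 'n) set" where
  "carleson_tent z =
     (if z = 0 then ball 0 1
      else {w \<in> ball 0 1. norm (1 - herm (z /\<^sub>R norm z) w) < 1 - norm z})"

definition carleson_measure :: "real \<Rightarrow> (complex ^ 'n) measure \<Rightarrow> bool" where
  "carleson_measure \<alpha> \<mu> \<longleftrightarrow>
     sets \<mu> = sets (restrict_space borel (ball 0 1)) \<and>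
     (SUP z\<in>ball 0 1. emeasure \<mu> (carleson_tent z) /
        emeasure (bergman_measure \<alpha>) (carleson_tent z)) < \<infinity>"

text \<open>The Borel measure \<open>\<mu>\<close> with \<open>\<integral> g d\<mu> = \<integral> |u|\<^sup>q (g \<circ> \<phi>) \<omega> dV\<^sub>\<alpha>\<close>, see the lemma below.\<close>

definition pushforward_measure ::
    "(complex ^ 'n \<Rightarrow> complex) \<Rightarrow> (complex ^ 'n \<Rightarrow> complex ^ 'n) \<Rightarrow> real \<Rightarrow>
     (complex ^ 'n \<Rightarrow> real) \<Rightarrow> real \<Rightarrow> (complex ^ 'n) measure" where
  "pushforward_measure u \<phi> q \<omega> \<alpha> =
     distr (density (bergman_measure \<alpha>) (\<lambda>z. ennreal (norm (u z) powr q * \<omega> z)))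
       (restrict_space borel (ball 0 1)) \<phi>"

lemma holo_on_continuous:
  assumes "holo_on f S"
  shows "continuous_on S f"
  using assms unfolding holo_on_def
  by (meson continuous_at_imp_continuous_on has_derivative_continuous)

lemma nn_integral_pushforward_measure:
  fixes u :: "complex ^ 'n \<Rightarrow> complex"
  assumes "holo_on u (ball 0 1)" "holo_self_map \<phi>" "weight \<omega>"
    and g: "g \<in> borel_measurable (restrict_space borel (ball 0 1))"
  shows "(\<integral>\<^sup>+ w. g w \<partial>pushforward_measure u \<phi> q \<omega> \<alpha>) =
    (\<integral>\<^sup>+ z. ennreal (norm (u z) powr q) * g (\<phi> z) * ennreal (\<omega> z) \<partial>bergman_measure \<alpha>)"
proof -
  let ?L = "lebesgue_on (ball (0 :: complex ^ 'n) 1)"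
  have ctoL: "f \<in> borel_measurable ?L"
    if "continuous_on (ball 0 1) f" for f :: "complex ^ 'n \<Rightarrow> 'b::euclidean_space"
    using that by (intro continuous_imp_measurable_on_sets_lebesgue) auto
  have u: "u \<in> borel_measurable ?L"
    by (intro ctoL holo_on_continuous assms)
  have "continuous_on (ball 0 1) (\<lambda>z. \<chi> i. \<phi> z $ i)"
    using assms(2) holo_on_continuous unfolding holo_self_map_def
    by (intro continuous_on_vec_lambda) blast
  then have "\<phi> \<in> borel_measurable ?L"
    by (intro ctoL) simp
  then have phi: "\<phi> \<in> measurable (bergman_measure \<alpha>) (restrict_space borel (ball 0 1))"
    using assms(2) unfolding holo_self_map_def bergman_measure_def
    by (intro measurable_restrict_space2) (auto simp: space_restrict_space)
  have om: "\<omega> \<in> borel_measurable ?L"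
    using assms(3) by (simp add: weight_def)
  have uw: "(\<lambda>z. ennreal (norm (u z) powr q * \<omega> z)) \<in> borel_measurable (bergman_measure \<alpha>)"
    using u om unfolding bergman_measure_def by simp
  have "(\<integral>\<^sup>+ w. g w \<partial>pushforward_measure u \<phi> q \<omega> \<alpha>) =
    (\<integral>\<^sup>+ z. g (\<phi> z) \<partial>density (bergman_measure \<alpha>) (\<lambda>z. ennreal (norm (u z) powr q * \<omega> z)))"
    unfolding pushforward_measure_def using phi g by (intro nn_integral_distr) auto
  also have "\<dots> =
    (\<integral>\<^sup>+ z. ennreal (norm (u z) powr q * \<omega> z) * g (\<phi> z) \<partial>bergman_measure \<alpha>)"
    by (intro nn_integral_density uw measurable_compose[OF phi g])
  also have "\<dots> =
    (\<integral>\<^sup>+ z. ennreal (norm (u z) powr q) * g (\<phi> z) * ennreal (\<omega> z) \<partial>bergman_measure \<alpha>)"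
    using assms(3) by (intro nn_integral_cong)
      (auto simp: bergman_measure_def space_restrict_space weight_def ennreal_mult mult_ac)
  finally show ?thesis .
qed

end

theory Submission
  imports Defs "HOL-Complex_Analysis.Cauchy_Integral_Formula"
begin

text \<open>Write \<open>m = \<alpha> + n + 1\<close>. The kernel integral that defines the class of weights carries the full
power \<open>m\<close> of \<open>|1 - \<langle>\<zeta>, \<phi>(z)\<rangle>|\<close>, and this is exactly the power in the sub-mean-value
inequality for Bergman spaces: for holomorphic \<open>f\<close>,
\<open>|f(w)|\<^sup>q \<le> C \<integral> |f(\<zeta>)|\<^sup>q |1 - \<langle>\<zeta>, w\<rangle>|\<^bsup>-m\<^esup> dV\<^sub>\<alpha>(\<zeta>)\<close>. Putting \<open>w = \<phi>(z)\<close>, integrating against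
\<open>|u|\<^sup>q \<omega>\<^bsup>s'\<^esup> dV\<^sub>\<alpha>\<close> and exchanging the integrals gives
\<open>\<integral> |u|\<^sup>q |f \<circ> \<phi>|\<^sup>q \<omega>\<^bsup>s'\<^esup> dV\<^sub>\<alpha> \<le> C M \<parallel>f\<parallel>\<^sup>q\<close>, where \<open>M\<close> is the weight constant of \<open>\<omega>\<^bsup>s'\<^esup>\<close>
(\<open>carleson_embedding\<close>). Boundedness of the weighted composition operator is the same estimate with the
weight \<open>1\<close>. The estimate for \<open>\<omega>\<close> itself lies between the two: for every \<open>k > 0\<close>,
\<open>\<omega> \<le> k + k\<^bsup>1-s'\<^esup> \<omega>\<^bsup>s'\<^esup>\<close>, and \<open>k = M\<^bsup>1/s'\<^esup>\<close> makes both terms of size \<open>M\<^bsup>1/s'\<^esup>\<close>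
(\<open>weighted_integral_le\<close>).

The pointwise inequality (\<open>holo_pointwise_le\<close>) is the mean value property over an ellipsoid about \<open>w\<close>
whose radii are comparable to \<open>1 - |w|\<close> in the complex direction of \<open>w\<close> and to the square root of
\<open>1 - |w|\<close> in the orthogonal directions. It is the image of the unit ball under an affine
complex-linear map, so the mean value property follows from the Cauchy formula on circles and the
invariance of Lebesgue measure under rotations. The volume of the ellipsoid is of order
\<open>(1 - |w|)\<^bsup>n+1\<^esup>\<close>, and on it \<open>1 - |z|\<^sup>2\<close> is comparable to \<open>1 - |w|\<close> and \<open>|1 - \<langle>z, w\<rangle>|\<close> is at most
\<open>3 (1 - |w|)\<close>; hence the power \<open>m\<close>.

The Carleson property follows from the inequality for \<open>\<omega>\<close> by testing it on \<open>f(z) = (1 - \<langle>z, a\<rangle>)\<^bsup>-N\<^esup>\<close> with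
\<open>N q > m\<close>. This needs \<open>V\<^sub>\<alpha>(T\<^sub>a) \<ge> c (1 - |a|)\<^sup>m\<close>, which is the pointwise inequality for \<open>f = 1\<close>, and the
bound \<open>\<integral> |1 - \<langle>z, a\<rangle>|\<^bsup>-Nq\<^esup> dV\<^sub>\<alpha>(z) \<le> C (1 - |a|)\<^bsup>m-Nq\<^esup>\<close> (\<open>kernel_integral_le\<close>). The latter is an
integration over the level sets of \<open>|1 - \<langle>z, e\<rangle>|\<close>, \<open>e\<close> the direction of \<open>a\<close>, once
\<open>V\<^sub>\<alpha>{|1 - \<langle>z, e\<rangle>| < \<tau>} \<le> C \<tau>\<^sup>m\<close> is known (\<open>emeasure_cap_le\<close>). For negative \<open>\<alpha>\<close> the weight is
unbounded there, and the bound comes from averaging over the dilations \<open>z \<mapsto> r z\<close>.\<close>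

section \<open>Linear substitutions in Lebesgue integrals\<close>

lemma nn_integral_lborel_shift:
  fixes G :: "'a::euclidean_space \<Rightarrow> ennreal"
  assumes [measurable]: "G \<in> borel_measurable borel"
  shows "(\<integral>\<^sup>+ x. G (a + x) \<partial>lborel) = (\<integral>\<^sup>+ x. G x \<partial>lborel)"
proof -
  have "(\<integral>\<^sup>+ x. G x \<partial>lborel) = (\<integral>\<^sup>+ x. G x \<partial>distr lborel borel ((+) a))"
    by (simp add: lborel_distr_plus)
  also have "\<dots> = (\<integral>\<^sup>+ x. G (a + x) \<partial>lborel)"
    by (subst nn_integral_distr) auto
  finally show ?thesis by simp
qed

lemma nn_integral_lborel_dilate:
  fixes G :: "'a::euclidean_space \<Rightarrow> ennreal"
  assumes [measurable]: "G \<in> borel_measurable borel" and "c > 0"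
  shows "(\<integral>\<^sup>+ x. G x \<partial>lborel) = ennreal (c ^ DIM('a)) * (\<integral>\<^sup>+ x. G (c *\<^sub>R x) \<partial>lborel)"
proof -
  have "c \<noteq> 0" using assms by simp
  show ?thesis
    by (subst lborel_affine[OF \<open>c \<noteq> 0\<close>, of 0])
      (use assms(2) in \<open>simp add: nn_integral_density nn_integral_distr nn_integral_cmult\<close>)
qed

text \<open>Let \<open>B\<close> be the indicator of the unit ball, which is invariant under \<open>- H\<close>. Translating \<open>y\<close> by \<open>H x\<close>,
or \<open>x\<close> by the preimage of \<open>y\<close>, in the double integral of \<open>G (H x) B (y - H x)\<close> shows that the integral
of \<open>G \<circ> H\<close> and the integral of \<open>G\<close> agree after multiplication by the volume of the ball. No
determinants are involved, so the argument works in every Euclidean space.\<close>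

lemma nn_integral_lborel_isometry:
  fixes G :: "'a::euclidean_space \<Rightarrow> ennreal" and H :: "'a \<Rightarrow> 'a"
  assumes [measurable]: "G \<in> borel_measurable borel"
    and H: "linear H" "\<And>x. norm (H x) = norm x"
  shows "(\<integral>\<^sup>+ x. G (H x) \<partial>lborel) = (\<integral>\<^sup>+ x. G x \<partial>lborel)"
proof -
  interpret linear H by fact
  have Hc: "continuous_on UNIV H"
    using H(1) linear_continuous_on linear_conv_bounded_linear by blast
  then have [measurable]: "H \<in> borel_measurable borel"
    by (rule borel_measurable_continuous_onI)
  have "inj H"
    unfolding linear_injective_0[OF H(1)] by (metis H(2) norm_eq_zero)
  then have "surj H"
    using linear_injective_imp_surjective[OF H(1)] by simp
  define B where "B = (indicator (ball 0 1) :: 'a \<Rightarrow> ennreal)"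
  have [measurable]: "B \<in> borel_measurable borel"
    unfolding B_def by (intro borel_measurable_indicator) simp
  let ?b = "integral\<^sup>N lborel B"
  have b: "?b \<noteq> 0" "?b \<noteq> \<infinity>"
    unfolding B_def using content_ball_pos[of 1 "0::'a"] emeasure_bounded_finite[of "ball (0::'a) 1"]
    by (auto simp: nn_integral_indicator emeasure_eq_ennreal_measure)
  have BH: "B (- H x) = B x" for x
    by (simp add: B_def H indicator_def)
  have "(\<integral>\<^sup>+ x. G (H x) \<partial>lborel) * ?b = (\<integral>\<^sup>+ x. G (H x) * (\<integral>\<^sup>+ y. B y \<partial>lborel) \<partial>lborel)"
    by (simp add: nn_integral_multc)
  also have "\<dots> = (\<integral>\<^sup>+ x. (\<integral>\<^sup>+ y. G (H x) * B (- H x + y) \<partial>lborel) \<partial>lborel)"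
    by (simp add: nn_integral_lborel_shift nn_integral_cmult del: uminus_add_conv_diff)
  also have "\<dots> = (\<integral>\<^sup>+ y. (\<integral>\<^sup>+ x. G (H x) * B (- H x + y) \<partial>lborel) \<partial>lborel)"
    by (rule lborel_pair.Fubini'[symmetric]) measurable
  also have "\<dots> = (\<integral>\<^sup>+ y. (\<integral>\<^sup>+ x. G (y + H x) * B (- H x) \<partial>lborel) \<partial>lborel)"
  proof (rule nn_integral_cong)
    fix y
    obtain x0 where y: "y = H x0"
      using \<open>surj H\<close> by blast
    show "(\<integral>\<^sup>+ x. G (H x) * B (- H x + y) \<partial>lborel) = (\<integral>\<^sup>+ x. G (y + H x) * B (- H x) \<partial>lborel)"
      by (subst nn_integral_lborel_shift[where a=x0, symmetric]) (auto simp: y add)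
  qed
  also have "\<dots> = (\<integral>\<^sup>+ x. (\<integral>\<^sup>+ y. G (H x + y) * B x \<partial>lborel) \<partial>lborel)"
    by (subst lborel_pair.Fubini') (simp_all add: BH add.commute)
  also have "\<dots> = (\<integral>\<^sup>+ y. G y \<partial>lborel) * ?b"
    by (simp add: nn_integral_lborel_shift nn_integral_multc nn_integral_cmult)
  finally show ?thesis
    using b by (simp add: mult.commute[of _ ?b] ennreal_mult_cancel_left)
qed

lemma nn_integral_lborel_stretch_basis:
  fixes G :: "'a::euclidean_space \<Rightarrow> ennreal"
  assumes [measurable]: "G \<in> borel_measurable borel" and "t > 0" and b: "b \<in> Basis"
  shows "(\<integral>\<^sup>+ x. G x \<partial>lborel) = ennreal t * (\<integral>\<^sup>+ x. G (x + ((t - 1) * (x \<bullet> b)) *\<^sub>R b) \<partial>lborel)"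
proof -
  define c where "c = (\<lambda>j::'a. if j = b then t else 1)"
  have T: "0 + (\<Sum>j\<in>Basis. (c j * (x \<bullet> j)) *\<^sub>R j) = x + ((t - 1) * (x \<bullet> b)) *\<^sub>R b" for x
  proof -
    have "(\<Sum>j\<in>Basis. (c j * (x \<bullet> j)) *\<^sub>R j)
      = (\<Sum>j\<in>Basis. (x \<bullet> j) *\<^sub>R j + (if j = b then ((t - 1) * (x \<bullet> b)) *\<^sub>R b else 0))"
      by (intro sum.cong) (auto simp: c_def algebra_simps)
    also have "\<dots> = x + ((t - 1) * (x \<bullet> b)) *\<^sub>R b"
      using b by (simp add: sum.distrib euclidean_representation)
    finally show ?thesis by simp
  qed
  have c: "c j \<noteq> 0" for j
    using assms by (simp add: c_def)
  have p: "(\<Prod>j\<in>Basis. \<bar>c j\<bar>) = t"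
    using b \<open>t > 0\<close> by (simp add: c_def if_distrib prod.delta cong: if_cong)
  show ?thesis
    by (subst lborel_affine_euclidean[of c 0, OF c])
      (simp add: nn_integral_density nn_integral_distr nn_integral_cmult p T[simplified])
qed

text \<open>A reflection carries a basis vector to \<open>e\<close> and preserves the measure, which reduces the stretch along
\<open>e\<close> to a stretch of one coordinate.\<close>

lemma nn_integral_lborel_stretch:
  fixes G :: "'a::euclidean_space \<Rightarrow> ennreal"
  assumes [measurable]: "G \<in> borel_measurable borel" and "t > 0" and e: "norm e = 1"
  shows "(\<integral>\<^sup>+ x. G x \<partial>lborel) = ennreal t * (\<integral>\<^sup>+ x. G (x + ((t - 1) * (x \<bullet> e)) *\<^sub>R e) \<partial>lborel)"
proof -
  obtain b :: 'a where b: "b \<in> Basis"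
    using nonempty_Basis by blast
  have [simp]: "b \<bullet> b = 1" "e \<bullet> e = 1"
    using b e by (auto simp: norm_eq_1)
  define d where "d = b - e"
  \<comment> \<open>the reflection exchanging \<open>b\<close> and \<open>e\<close>\<close>
  define H where "H = (\<lambda>x. x - (2 * (x \<bullet> d) / (d \<bullet> d)) *\<^sub>R d)"
  have dd: "d \<bullet> d = 2 - 2 * (b \<bullet> e)"
    by (simp add: d_def inner_diff_left inner_diff_right inner_commute)
  have lin: "linear H"
    by (rule linearI) (simp_all add: H_def inner_add_left algebra_simps add_divide_distrib)
  have inn: "H x \<bullet> H y = x \<bullet> y" for x y
  proof (cases "d = 0")
    case False
    then have *: "d \<bullet> d \<noteq> 0" by simp
    define p where "p = 2 * (x \<bullet> d) / (d \<bullet> d)"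
    define r where "r = 2 * (y \<bullet> d) / (d \<bullet> d)"
    have "p * (d \<bullet> d) = 2 * (x \<bullet> d)" "r * (d \<bullet> d) = 2 * (y \<bullet> d)"
      using * by (auto simp: p_def r_def)
    then have "p * (r * (d \<bullet> d)) = r * (x \<bullet> d) + p * (y \<bullet> d)"
      by algebra
    moreover have "H x \<bullet> H y = x \<bullet> y - r * (x \<bullet> d) - p * (y \<bullet> d) + p * (r * (d \<bullet> d))"
      unfolding H_def p_def[symmetric] r_def[symmetric]
      by (simp add: inner_diff_left inner_diff_right inner_commute algebra_simps)
    ultimately show ?thesis by simp
  qed (simp add: H_def)
  have Hb: "H b = e"
  proof (cases "d = 0")
    case False
    have "b \<bullet> d = (d \<bullet> d) / 2"
      unfolding dd by (simp add: d_def inner_diff_right)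
    then have "2 * (b \<bullet> d) / (d \<bullet> d) = 1"
      using False by simp
    then have "H b = b - 1 *\<^sub>R d"
      unfolding H_def by (simp only:)
    then show ?thesis
      by (simp add: d_def)
  qed (auto simp: H_def d_def)
  have nH: "norm (H x) = norm x" for x
    by (simp add: norm_eq_sqrt_inner inn)
  have [measurable]: "H \<in> borel_measurable borel"
    using lin by (intro borel_measurable_continuous_onI linear_continuous_on) (simp add: linear_conv_bounded_linear)
  have Hs: "H (x + ((t - 1) * (x \<bullet> b)) *\<^sub>R b) = H x + ((t - 1) * (H x \<bullet> e)) *\<^sub>R e" for x
    using inn[of x b] by (simp add: linear_add[OF lin] linear_cmul[OF lin] Hb)
  have "(\<integral>\<^sup>+ x. G x \<partial>lborel) = (\<integral>\<^sup>+ x. G (H x) \<partial>lborel)"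
    by (rule nn_integral_lborel_isometry[symmetric]) (use lin nH in auto)
  also have "\<dots> = ennreal t * (\<integral>\<^sup>+ x. G (H (x + ((t - 1) * (x \<bullet> b)) *\<^sub>R b)) \<partial>lborel)"
    by (rule nn_integral_lborel_stretch_basis) (use assms b in auto)
  also have "\<dots> = ennreal t * (\<integral>\<^sup>+ x. G (H x + ((t - 1) * (H x \<bullet> e)) *\<^sub>R e) \<partial>lborel)"
    by (simp only: Hs)
  also have "(\<integral>\<^sup>+ x. G (H x + ((t - 1) * (H x \<bullet> e)) *\<^sub>R e) \<partial>lborel)
    = (\<integral>\<^sup>+ x. G (x + ((t - 1) * (x \<bullet> e)) *\<^sub>R e) \<partial>lborel)"
    by (rule nn_integral_lborel_isometry) (use lin nH in auto)
  finally show ?thesis .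
qed

section \<open>The Hermitian product and parabolic scalings\<close>

lemma herm_add_left: "herm (x + y) w = herm x w + herm y w"
  by (simp add: herm_def algebra_simps sum.distrib)

lemma herm_smult_left: "herm (c *s x) w = c * herm x w"
  by (simp add: herm_def algebra_simps sum_distrib_left)

lemma herm_commute: "herm w z = cnj (herm z w)"
  by (simp add: herm_def mult.commute)

lemma scaleR_eq_smult: "r *\<^sub>R (x :: complex ^ 'n) = of_real r *s x"
  by (simp add: vec_eq_iff scaleR_conv_of_real[symmetric])

lemma herm_scaleR_left: "herm (r *\<^sub>R x) w = of_real r * herm x w"
  by (simp add: scaleR_eq_smult herm_smult_left)

lemma herm_diff_left: "herm (x - y) w = herm x w - herm y w"
  by (simp add: herm_def algebra_simps sum_subtractf)

lemma herm_add_right: "herm w (x + y) = herm w x + herm w y"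
  by (simp add: herm_def algebra_simps sum.distrib)

lemma herm_diff_right: "herm w (x - y) = herm w x - herm w y"
  by (simp add: herm_def algebra_simps sum_subtractf)

lemma herm_smult_right: "herm w (c *s x) = cnj c * herm w x"
  by (simp add: herm_def algebra_simps sum_distrib_left)

lemma herm_scaleR_right: "herm w (r *\<^sub>R x) = of_real r * herm w x"
  by (simp add: scaleR_eq_smult herm_smult_right)

lemma herm_zero [simp]: "herm 0 w = 0" "herm w 0 = 0"
  by (simp_all add: herm_def)

lemma inner_eq_Re_herm: "z \<bullet> w = Re (herm z w)"
  by (simp add: herm_def inner_vec_def inner_complex_def)

lemma herm_self: "herm z z = of_real ((norm z)\<^sup>2)"
proof -
  have "Im (herm z z) = 0"
    by (simp add: herm_def mult.commute)
  moreover have "Re (herm z z) = (norm z)\<^sup>2"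
    by (simp add: inner_eq_Re_herm[symmetric] power2_norm_eq_inner)
  ultimately show ?thesis
    by (simp add: complex_eq_iff)
qed

lemma norm_smult_complex: "norm (c *s (x :: complex ^ 'n)) = norm c * norm x"
proof (rule power2_eq_imp_eq)
  have "complex_of_real ((norm (c *s x))\<^sup>2) = herm (c *s x) (c *s x)"
    by (simp only: herm_self)
  also have "\<dots> = (c * cnj c) * of_real ((norm x)\<^sup>2)"
    unfolding herm_smult_left herm_smult_right unfolding herm_self by simp
  also have "\<dots> = of_real ((norm c * norm x)\<^sup>2)"
    by (simp only: power_mult_distrib of_real_mult complex_norm_square)
  finally have "complex_of_real ((norm (c *s x))\<^sup>2) = of_real ((norm c * norm x)\<^sup>2)" .
  then show "(norm (c *s x))\<^sup>2 = (norm c * norm x)\<^sup>2"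
    by (simp only: of_real_eq_iff)
qed auto

lemma unimodular_rotation:
  obtains c :: complex where "norm c = 1" "c * z = of_real (norm z)"
proof (cases "z = 0")
  case False
  have "cnj z / of_real (norm z) * z = of_real (norm z)"
    using False complex_norm_square[of z]
    by (simp add: field_simps power2_eq_square)
  moreover have "norm (cnj z / of_real (norm z)) = 1"
    using False by (simp add: norm_divide)
  ultimately show thesis
    using that by blast
qed (use that[of 1] in auto)

lemma norm_herm_le: "norm (herm z w) \<le> norm z * norm w"
proof -
  obtain c where c: "norm c = 1" "c * herm z w = of_real (norm (herm z w))"
    using unimodular_rotation by blast
  have "norm (herm z w) = (c *s z) \<bullet> w"
    by (simp add: inner_eq_Re_herm herm_smult_left c)
  also have "\<dots> \<le> norm z * norm w"
    using norm_cauchy_schwarz[of "c *s z" w] by (simp add: norm_smult_complex c)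
  finally show ?thesis .
qed

lemma continuous_on_herm [continuous_intros]:
  "continuous_on S f \<Longrightarrow> continuous_on S g \<Longrightarrow> continuous_on S (\<lambda>x. herm (f x) (g x))"
  unfolding herm_def by (intro continuous_intros)

lemma norm_add_orthogonal_sq:
  assumes "herm b e = 0" "norm e = 1"
  shows "(norm (a *s e + b))\<^sup>2 = (norm a)\<^sup>2 + (norm b)\<^sup>2"
proof -
  have "herm e b = 0"
    using assms(1) herm_commute[of e b] by simp
  have "complex_of_real ((norm (a *s e + b))\<^sup>2) = herm (a *s e + b) (a *s e + b)"
    by (simp only: herm_self)
  also have "\<dots> = a * cnj a + of_real ((norm b)\<^sup>2)"
    unfolding herm_add_left herm_add_right herm_smult_left herm_smult_right
    unfolding herm_self by (simp add: assms \<open>herm e b = 0\<close>)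
  also have "\<dots> = of_real ((norm a)\<^sup>2 + (norm b)\<^sup>2)"
    by (simp only: of_real_add complex_norm_square)
  finally have "complex_of_real ((norm (a *s e + b))\<^sup>2) = of_real ((norm a)\<^sup>2 + (norm b)\<^sup>2)" .
  then show ?thesis
    by (simp only: of_real_eq_iff)
qed

text \<open>The map \<open>v \<mapsto> t v\<close> on the orthogonal complement of the complex line of \<open>e\<close>, and \<open>v \<mapsto> t\<^sup>2 v\<close> on that line: the
scaling that is natural near the boundary point \<open>e\<close> of the ball, where the tangential directions
count with half the weight of the normal one.\<close>

definition parabolic :: "real \<Rightarrow> complex ^ 'n \<Rightarrow> complex ^ 'n \<Rightarrow> complex ^ 'n" where
  "parabolic t e v = t *\<^sub>R v + (of_real (t\<^sup>2 - t) * herm v e) *s e"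

lemma parabolic_smult: "parabolic t e (c *s v) = c *s parabolic t e v"
  by (simp add: parabolic_def vec_eq_iff herm_smult_left algebra_simps)

lemma continuous_on_smult [continuous_intros]:
  fixes g :: "_ \<Rightarrow> complex ^ 'n"
  shows "continuous_on S f \<Longrightarrow> continuous_on S g \<Longrightarrow> continuous_on S (\<lambda>x. f x *s g x)"
  unfolding vector_scalar_mult_def by (intro continuous_intros)

lemma borel_measurable_parabolic [measurable]: "parabolic t e \<in> borel_measurable borel"
  unfolding parabolic_def by (intro borel_measurable_continuous_onI continuous_intros)

lemma herm_parabolic:
  assumes "norm e = 1"
  shows "herm (parabolic t e v) e = of_real (t\<^sup>2) * herm v e"
  unfolding parabolic_def herm_add_left herm_smult_left herm_scaleR_left herm_self
  by (simp add: assms algebra_simps)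

text \<open>The scaling is the dilation by \<open>t\<close> composed with the real stretches by \<open>t\<close> along the orthogonal unit
vectors \<open>e\<close> and \<open>\<i> e\<close>.\<close>

lemma nn_integral_lborel_parabolic:
  fixes G :: "complex ^ 'n \<Rightarrow> ennreal"
  assumes [measurable]: "G \<in> borel_measurable borel" and "t > 0" and e: "norm e = 1"
  shows "(\<integral>\<^sup>+ x. G x \<partial>lborel)
    = ennreal (t ^ (2 * CARD('n) + 2)) * (\<integral>\<^sup>+ v. G (parabolic t e v) \<partial>lborel)"
proof -
  define f where "f = \<i> *s e"
  have nf: "norm f = 1"
    by (simp add: f_def norm_smult_complex e)
  have fe: "f \<bullet> e = 0"
    by (simp add: f_def inner_eq_Re_herm herm_smult_left herm_self)
  have split: "t *\<^sub>R ((v + ((t - 1) * (v \<bullet> f)) *\<^sub>R f) + ((t - 1) * ((v + ((t - 1) * (v \<bullet> f)) *\<^sub>R f) \<bullet> e)) *\<^sub>R e)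
    = parabolic t e v" for v
  proof -
    have "v \<bullet> f = Im (herm v e)"
      by (simp add: f_def inner_eq_Re_herm herm_smult_right)
    moreover have "v \<bullet> e = Re (herm v e)"
      by (simp add: inner_eq_Re_herm)
    moreover have "of_real (Re (herm v e)) + \<i> * of_real (Im (herm v e)) = herm v e"
      by (simp add: complex_eq_iff)
    ultimately have "((v \<bullet> f)) *\<^sub>R f + ((v \<bullet> e)) *\<^sub>R e = herm v e *s e"
      by (simp add: f_def scaleR_eq_smult vector_smult_assoc vector_sadd_rdistrib[symmetric]
          add.commute mult.commute)
    moreover have "t *\<^sub>R ((v + ((t - 1) * (v \<bullet> f)) *\<^sub>R f) + ((t - 1) * ((v + ((t - 1) * (v \<bullet> f)) *\<^sub>R f) \<bullet> e)) *\<^sub>R e)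
      = t *\<^sub>R v + (t\<^sup>2 - t) *\<^sub>R (((v \<bullet> f)) *\<^sub>R f + ((v \<bullet> e)) *\<^sub>R e)"
      by (simp add: inner_add_left fe algebra_simps power2_eq_square)
    ultimately show ?thesis
      by (simp add: parabolic_def scaleR_eq_smult vector_smult_assoc)
  qed
  have [measurable]: "(\<lambda>x. G (t *\<^sub>R (x + ((t - 1) * (x \<bullet> e)) *\<^sub>R e))) \<in> borel_measurable borel"
    by measurable
  have "(\<integral>\<^sup>+ x. G x \<partial>lborel) = ennreal (t ^ (2 * CARD('n))) * (\<integral>\<^sup>+ x. G (t *\<^sub>R x) \<partial>lborel)"
    by (subst nn_integral_lborel_dilate[of G t]) (use assms in \<open>simp_all add: mult.commute\<close>)
  also have "(\<integral>\<^sup>+ x. G (t *\<^sub>R x) \<partial>lborel)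
    = ennreal t * (\<integral>\<^sup>+ x. G (t *\<^sub>R (x + ((t - 1) * (x \<bullet> e)) *\<^sub>R e)) \<partial>lborel)"
    by (rule nn_integral_lborel_stretch) (use assms in auto)
  also have "(\<integral>\<^sup>+ x. G (t *\<^sub>R (x + ((t - 1) * (x \<bullet> e)) *\<^sub>R e)) \<partial>lborel)
    = ennreal t * (\<integral>\<^sup>+ v. G (parabolic t e v) \<partial>lborel)"
    by (subst nn_integral_lborel_stretch[where t=t and e=f]) (use assms nf in \<open>auto simp: split\<close>)
  finally have "(\<integral>\<^sup>+ x. G x \<partial>lborel)
    = (ennreal (t ^ (2 * CARD('n))) * (ennreal t * ennreal t)) * (\<integral>\<^sup>+ v. G (parabolic t e v) \<partial>lborel)"
    by (simp only: mult.assoc)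
  also have "ennreal (t ^ (2 * CARD('n))) * (ennreal t * ennreal t) = ennreal (t ^ (2 * CARD('n) + 2))"
    using \<open>t > 0\<close> by (simp only: power_add power2_eq_square) (simp flip: ennreal_mult)
  finally show ?thesis .
qed

section \<open>The sub-mean-value inequality\<close>

text \<open>The graph of \<open>x \<mapsto> x\<^sup>q\<close> lies above its tangent at \<open>a\<close>. This is Young's inequality for the product of
\<open>x\<close> and \<open>a\<^bsup>q-1\<^esup>\<close>.\<close>

lemma powr_tangent_le:
  fixes a x q :: real
  assumes "a > 0" "x \<ge> 0" "q > 1"
  shows "a powr q + q * a powr (q - 1) * (x - a) \<le> x powr q"
proof -
  define q' where "q' = q / (q - 1)"
  have q': "q' > 1" "1 / q + 1 / q' = 1" "q' * (q - 1) = q"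
    using assms by (auto simp: q'_def field_simps)
  have "x * a powr (q - 1) \<le> x powr q / q + (a powr (q - 1)) powr q' / q'"
    by (rule Youngs_inequality) (use assms q' in auto)
  also have "(a powr (q - 1)) powr q' = a powr q"
    using q' by (simp add: powr_powr mult.commute)
  also have "1 / q' = 1 - 1 / q"
    using q' by simp
  then have "a powr q / q' = a powr q - a powr q / q"
    by (metis (no_types) divide_inverse inverse_eq_divide mult.right_neutral right_diff_distrib)
  finally have "q * (x * a powr (q - 1)) \<le> q * (x powr q / q + (a powr q - a powr q / q))"
    using assms by (intro mult_left_mono) auto
  moreover have "a powr (q - 1) * a = a powr q"
    using assms by (simp add: powr_diff)
  ultimately show ?thesis
    using assms by (simp add: algebra_simps)
qed

text \<open>Rotate \<open>h\<close> so that its value at the centre is \<open>|h(0)|\<close>. The mean of the real part is then \<open>|h(0)|\<close> by the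
Cauchy formula, and the tangent of \<open>x \<mapsto> x\<^sup>q\<close> at this point gives a lower bound for \<open>|h|\<^sup>q\<close> that is
affine in the real part, so that it can be averaged.\<close>

lemma circle_mean_powr_ge:
  fixes h :: "complex \<Rightarrow> complex"
  assumes h: "h holomorphic_on cball 0 1" and q: "q > 1"
  shows "ennreal (2 * pi * norm (h 0) powr q)
    \<le> (\<integral>\<^sup>+ t. ennreal (norm (h (cis t)) powr q) * indicator {0..2 * pi} t \<partial>lborel)"
proof (cases "h 0 = 0")
  case False
  define a where "a = norm (h 0)"
  have a: "a > 0"
    using False by (simp add: a_def)
  obtain \<sigma> where s: "\<sigma> * h 0 = of_real a" "norm \<sigma> = 1"
    unfolding a_def using unimodular_rotation by blast
  have cis: "cis t \<in> cball 0 1" for t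
    by simp
  have hc: "continuous_on {0..2 * pi} (\<lambda>t. h (cis t))"
    by (rule continuous_on_compose2[OF holomorphic_on_imp_continuous_on[OF h]])
      (auto intro: continuous_intros)
  have "((\<lambda>u. h u / (u - 0)) has_contour_integral (2 * of_real pi * \<i> * h 0)) (circlepath 0 1)"
    by (rule Cauchy_integral_circlepath_simple[OF h]) simp
  then have "((\<lambda>t. h (cis t) * \<i>) has_integral (2 * of_real pi * \<i> * h 0)) {0..2 * pi}"
    unfolding circlepath_def by (subst (asm) has_contour_integral_part_circlepath_iff) auto
  then have *: "((\<lambda>t. (h (cis t) * \<i>) * (- \<i> * \<sigma>)) has_integral (2 * of_real pi * \<i> * h 0) * (- \<i> * \<sigma>)) {0..2 * pi}"
    by (rule has_integral_mult_left)
  have "((\<lambda>t. \<sigma> * h (cis t)) has_integral (2 * of_real pi * of_real a)) {0..2 * pi}"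
  proof -
    have eq: "x * \<i> * (- \<i> * \<sigma>) = \<sigma> * x" for x
      by (simp add: complex_eq_iff algebra_simps)
    then have "h (cis t) * \<i> * (- \<i> * \<sigma>) = \<sigma> * h (cis t)" for t .
    moreover have "2 * of_real pi * \<i> * h 0 * (- \<i> * \<sigma>) = 2 * of_real pi * of_real a"
      using eq[of "2 * of_real pi * h 0"] by (simp flip: s(1) add: mult_ac)
    ultimately show ?thesis
      using * by (simp only:)
  qed
  then have "((\<lambda>t. Re (\<sigma> * h (cis t))) has_integral (2 * pi * a)) {0..2 * pi}"
    by (rule has_integral_eq_rhs[OF has_integral_Re]) simp
  then have "((\<lambda>t. (q * a powr (q - 1)) * Re (\<sigma> * h (cis t))) has_integral (q * a powr (q - 1)) * (2 * pi * a)) {0..2 * pi}"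
    by (rule has_integral_mult_right)
  moreover have "((\<lambda>t. a powr q - q * a powr (q - 1) * a) has_integral (2 * pi) * (a powr q - q * a powr (q - 1) * a)) {0..2 * pi}"
    using has_integral_const_real[of "a powr q - q * a powr (q - 1) * a" 0 "2 * pi"] by simp
  ultimately have 1: "((\<lambda>t. (q * a powr (q - 1)) * Re (\<sigma> * h (cis t)) + (a powr q - q * a powr (q - 1) * a))
      has_integral (q * a powr (q - 1)) * (2 * pi * a) + (2 * pi) * (a powr q - q * a powr (q - 1) * a)) {0..2 * pi}"
    by (rule has_integral_add)
  define g where "g = (\<lambda>t. norm (h (cis t)) powr q)"
  have gc: "continuous_on {0..2 * pi} g"
    unfolding g_def using q by (intro continuous_on_powr' continuous_intros hc) auto
  define J where "J = integral {0..2 * pi} g"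
  have 2: "(g has_integral J) {0..2 * pi}"
    unfolding J_def using gc integrable_continuous_interval by (intro integrable_integral) blast
  have "2 * pi * a powr q \<le> J"
  proof -
    have "(q * a powr (q - 1)) * (2 * pi * a) + (2 * pi) * (a powr q - q * a powr (q - 1) * a) \<le> J"
    proof (rule has_integral_le[OF 1 2])
      fix t
      have "Re (\<sigma> * h (cis t)) \<le> norm (h (cis t))"
        using complex_Re_le_cmod[of "\<sigma> * h (cis t)"] s(2) by (simp add: norm_mult)
      then have "q * a powr (q - 1) * Re (\<sigma> * h (cis t)) \<le> q * a powr (q - 1) * norm (h (cis t))"
        using q a by (intro mult_left_mono) auto
      moreover have "a powr q + q * a powr (q - 1) * (norm (h (cis t)) - a) \<le> g t"
        unfolding g_def by (rule powr_tangent_le) (use a q in auto)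
      ultimately show "(q * a powr (q - 1)) * Re (\<sigma> * h (cis t)) + (a powr q - q * a powr (q - 1) * a) \<le> g t"
        by (simp add: algebra_simps)
    qed
    then show ?thesis by (simp add: algebra_simps)
  qed
  moreover have "(\<integral>\<^sup>+ t. ennreal (g t) * indicator {0..2 * pi} t \<partial>lborel) = ennreal J"
    by (rule nn_integral_has_integral_lebesgue'[OF _ 2]) (simp add: g_def)
  ultimately show ?thesis
    by (simp add: a_def g_def ennreal_leI)
qed (use q in simp)


lemma has_derivative_smult_left:
  fixes x :: "complex ^ 'n"
  shows "((\<lambda>l. w + l *s x) has_derivative (\<lambda>l. l *s x)) (at l)"
proof -
  have "bounded_linear (\<lambda>l. l *s x)"
    unfolding linear_conv_bounded_linear[symmetric]
    by (rule linearI) (simp_all add: vec_eq_iff algebra_simps)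
  then have "((\<lambda>l. l *s x) has_derivative (\<lambda>l. l *s x)) (at l)"
    by (rule bounded_linear_imp_has_derivative)
  from has_derivative_add[OF has_derivative_const this] show ?thesis
    by simp
qed

lemma holo_on_slice:
  assumes f: "holo_on f (ball 0 1)" and w: "\<And>l. norm l \<le> 1 \<Longrightarrow> w + l *s x \<in> ball 0 1"
  shows "(\<lambda>l. f (w + l *s x)) holomorphic_on cball 0 1"
  unfolding holomorphic_on_def
proof
  fix l :: complex
  assume "l \<in> cball 0 1"
  then obtain D where D: "(f has_derivative D) (at (w + l *s x))" "\<And>c v. D (c *s v) = c * D v"
    using f w[of l] unfolding holo_on_def by fastforce
  have "((\<lambda>l. f (w + l *s x)) has_derivative (\<lambda>h. D (h *s x))) (at l)"
    by (rule has_derivative_compose[OF has_derivative_smult_left D(1)])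
  moreover have "(\<lambda>h. D (h *s x)) = (*) (D x)"
    by (simp add: fun_eq_iff D(2))
  ultimately have "((\<lambda>l. f (w + l *s x)) has_field_derivative D x) (at l)"
    by (simp add: has_field_derivative_def)
  then show "(\<lambda>l. f (w + l *s x)) field_differentiable at l within cball 0 1"
    using field_differentiable_at_within field_differentiable_def by blast
qed

text \<open>Average the one-variable inequality on the circles \<open>cis t *s v\<close> over all \<open>v\<close> in the unit ball; since
rotations preserve the volume, each angle contributes the same integral over the ball.\<close>

lemma mean_value_parabolic:
  fixes f :: "complex ^ 'n \<Rightarrow> complex"
  assumes f: "holo_on f (ball 0 1)" and q: "q > 1"
    and w: "\<And>v. v \<in> ball 0 1 \<Longrightarrow> w + parabolic t e v \<in> ball 0 1"
  shows "ennreal (norm (f w) powr q) * emeasure lborel (ball (0 :: complex ^ 'n) 1)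
    \<le> (\<integral>\<^sup>+ v. ennreal (norm (f (w + parabolic t e v)) powr q) * indicator (ball 0 1) v \<partial>lborel)"
proof -
  define F0 where "F0 = (\<lambda>v. indicator (ball 0 1) v *\<^sub>R (norm (f (w + parabolic t e v)) powr q))"
  have "continuous_on (ball 0 1) (\<lambda>v. f (w + parabolic t e v))"
  proof (rule continuous_on_compose2[OF holo_on_continuous[OF f]])
    show "continuous_on (ball 0 1) (\<lambda>v. w + parabolic t e v)"
      unfolding parabolic_def by (intro continuous_intros)
  qed (use w in auto)
  then have F0[measurable]: "F0 \<in> borel_measurable borel"
    unfolding F0_def using q
    by (intro borel_measurable_continuous_on_indicator continuous_on_powr' continuous_intros) auto
  define F where "F = (\<lambda>v. ennreal (F0 v))"
  have F[measurable]: "F \<in> borel_measurable borel"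
    unfolding F_def by measurable
  have F_eq: "F v = ennreal (norm (f (w + parabolic t e v)) powr q) * indicator (ball 0 1) v" for v
    by (simp add: F_def F0_def indicator_def)
  have "continuous_on UNIV (\<lambda>x :: (complex ^ 'n) \<times> real. cis (snd x) *s fst x)"
    by (intro continuous_intros)
  then have [measurable]: "(\<lambda>x :: (complex ^ 'n) \<times> real. cis (snd x) *s fst x) \<in> borel_measurable borel"
    by (rule borel_measurable_continuous_onI)
  have Fm: "(\<lambda>(v, t). F (cis t *s v) * indicator {0..2 * pi} t) \<in> borel_measurable (lborel \<Otimes>\<^sub>M lborel)"
  proof -
    have "(\<lambda>x. F (cis (snd x) *s fst x)) \<in> borel_measurable (borel :: ((complex ^ 'n) \<times> real) measure)"
      by measurable
    then have "(\<lambda>x. F (cis (snd x) *s fst x)) \<in> borel_measurable (lborel \<Otimes>\<^sub>M lborel)"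
      by (simp add: borel_prod[symmetric] cong: measurable_cong_sets sets_pair_measure_cong)
    then show ?thesis
      unfolding split_beta by measurable
  qed
  have "ennreal (2 * pi) * (ennreal (norm (f w) powr q) * emeasure lborel (ball (0 :: complex ^ 'n) 1))
    = (\<integral>\<^sup>+ v. ennreal (2 * pi * norm (f w) powr q) * indicator (ball (0 :: complex ^ 'n) 1) v \<partial>lborel)"
    by (subst nn_integral_cmult_indicator) (simp_all add: ennreal_mult mult.assoc)
  also have "\<dots> \<le> (\<integral>\<^sup>+ v. (\<integral>\<^sup>+ t. F (cis t *s v) * indicator {0..2 * pi} t \<partial>lborel) \<partial>lborel)"
  proof (rule nn_integral_mono)
    fix v :: "complex ^ 'n"
    show "ennreal (2 * pi * norm (f w) powr q) * indicator (ball 0 1) v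
      \<le> (\<integral>\<^sup>+ t. F (cis t *s v) * indicator {0..2 * pi} t \<partial>lborel)"
    proof (cases "v \<in> ball 0 1")
      case True
      then have lv: "l *s v \<in> ball 0 1" if "norm l \<le> 1" for l
        using mult_right_mono[OF that norm_ge_zero[of v]] by (simp add: norm_smult_complex)
      have "(\<lambda>l. f (w + l *s parabolic t e v)) holomorphic_on cball 0 1"
        using w[OF lv] by (intro holo_on_slice f) (simp add: parabolic_smult)
      from circle_mean_powr_ge[OF this q] show ?thesis
        using True lv by (simp add: F_eq parabolic_smult indicator_def)
    qed simp
  qed
  also have "\<dots> = (\<integral>\<^sup>+ t. (\<integral>\<^sup>+ v. F (cis t *s v) * indicator {0..2 * pi} t \<partial>lborel) \<partial>lborel)"
    by (rule lborel_pair.Fubini'[OF Fm, symmetric])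
  also have "\<dots> = (\<integral>\<^sup>+ t. (\<integral>\<^sup>+ v. F v \<partial>lborel) * indicator {0..2 * pi} t \<partial>lborel)"
  proof (rule nn_integral_cong)
    fix t :: real
    have lin: "linear (\<lambda>v :: complex ^ 'n. cis t *s v)"
      by (rule linearI) (simp_all add: vec_eq_iff algebra_simps)
    then have [measurable]: "(\<lambda>v :: complex ^ 'n. cis t *s v) \<in> borel_measurable borel"
      by (intro borel_measurable_continuous_onI linear_continuous_on) (simp add: linear_conv_bounded_linear)
    have "(\<integral>\<^sup>+ v. F (cis t *s v) \<partial>lborel) = (\<integral>\<^sup>+ v. F v \<partial>lborel)"
      by (rule nn_integral_lborel_isometry[OF F lin]) (simp add: norm_smult_complex)
    then show "(\<integral>\<^sup>+ v. F (cis t *s v) * indicator {0..2 * pi} t \<partial>lborel)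
      = (\<integral>\<^sup>+ v. F v \<partial>lborel) * indicator {0..2 * pi} t"
      by (simp add: nn_integral_multc)
  qed
  also have "\<dots> = ennreal (2 * pi) * (\<integral>\<^sup>+ v. F v \<partial>lborel)"
    by (simp add: nn_integral_cmult mult.commute)
  finally show ?thesis
    using ennreal_mult_le_mult_iff[of "ennreal (2 * pi)"] by (simp add: F_eq)
qed

section \<open>Total mass of the weight\<close>

lemma powr_abs_bounds:
  fixes x K a :: real
  assumes "1 / K \<le> x" "x \<le> K" "K \<ge> 1"
  shows "x powr a \<le> K powr \<bar>a\<bar>" "K powr (- \<bar>a\<bar>) \<le> x powr a"
proof -
  have x: "x > 0" "1 / K > 0"
    using assms by (auto intro: less_le_trans[of 0 "1 / K"])
  have "ln x \<le> ln K"
    by (rule ln_le_cancel_iff[THEN iffD2, OF x(1) _ assms(2)]) (use assms(3) in linarith)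
  moreover have "ln (1 / K) \<le> ln x"
    by (rule ln_le_cancel_iff[THEN iffD2, OF x(2) x(1) assms(1)])
  then have "- ln K \<le> ln x"
    using assms by (simp add: ln_div)
  ultimately have "\<bar>ln x\<bar> \<le> ln K"
    by linarith
  then have "\<bar>a\<bar> * \<bar>ln x\<bar> \<le> \<bar>a\<bar> * ln K"
    by (intro mult_left_mono) auto
  then have "\<bar>a * ln x\<bar> \<le> \<bar>a\<bar> * ln K"
    by (simp add: abs_mult)
  then show "x powr a \<le> K powr \<bar>a\<bar>" "K powr (- \<bar>a\<bar>) \<le> x powr a"
    using x assms by (auto simp: powr_def)
qed

lemma nn_integral_powr_le_affine:
  fixes \<rho> \<delta> \<alpha> :: real
  assumes "\<alpha> > -1" "\<rho> > 0" "\<delta> \<ge> 0"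
  shows "(\<integral>\<^sup>+ r. ennreal ((1 - r * \<rho>) powr \<alpha>) * indicator {0..\<delta>} (1 - r * \<rho>) \<partial>lborel)
    = ennreal (\<delta> powr (\<alpha> + 1) / ((\<alpha> + 1) * \<rho>))"
proof -
  define f where "f = (\<lambda>s. ennreal (s powr \<alpha>) * indicator {0..\<delta>} s)"
  have [measurable]: "f \<in> borel_measurable borel"
    unfolding f_def by measurable
  have "(\<integral>\<^sup>+ s. f s \<partial>lborel) = ennreal (\<delta> powr (\<alpha> + 1) / (\<alpha> + 1))"
    unfolding f_def using assms
    by (intro nn_integral_has_integral_lebesgue' has_integral_powr_from_0) auto
  moreover have "(\<integral>\<^sup>+ s. f s \<partial>lborel) = ennreal \<rho> * (\<integral>\<^sup>+ r. f (1 + (- \<rho>) * r) \<partial>lborel)"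
    using nn_integral_real_affine[of f "- \<rho>" 1] assms by simp
  ultimately have "ennreal (1 / \<rho>) * (ennreal \<rho> * (\<integral>\<^sup>+ r. f (1 + (- \<rho>) * r) \<partial>lborel))
    = ennreal (1 / \<rho>) * ennreal (\<delta> powr (\<alpha> + 1) / (\<alpha> + 1))"
    by simp
  moreover have "ennreal (1 / \<rho>) * ennreal \<rho> = 1"
    using assms by (simp flip: ennreal_mult)
  moreover have "ennreal (1 / \<rho>) * ennreal (\<delta> powr (\<alpha> + 1) / (\<alpha> + 1))
    = ennreal (\<delta> powr (\<alpha> + 1) / ((\<alpha> + 1) * \<rho>))"
    using assms by (simp add: mult.commute flip: ennreal_mult)
  ultimately have "(\<integral>\<^sup>+ r. f (1 + (- \<rho>) * r) \<partial>lborel) = ennreal (\<delta> powr (\<alpha> + 1) / ((\<alpha> + 1) * \<rho>))"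
    by (simp add: mult.assoc[symmetric])
  then show ?thesis
    by (simp add: f_def mult.commute)
qed

text \<open>If \<open>\<alpha>\<close> is negative, the weight is unbounded near the sphere, but along each ray it is integrable. Averaging
the integral over the dilations \<open>z \<mapsto> r z\<close> with \<open>1 \<le> r \<le> 1 + \<delta>\<close>, each of which changes it only by a
bounded factor, replaces the weight by its mean along rays; that mean is of order \<open>\<delta>\<^sup>\<alpha>\<close>. The set \<open>S'\<close>
is whatever the dilated copies of \<open>S\<close> sweep out.\<close>

lemma weighted_shell_le:
  fixes \<alpha> :: real
  assumes \<alpha>: "\<alpha> > -1"
  obtains K where "K > 0"
    "\<And>\<delta> S S'. \<lbrakk>0 < \<delta>; \<delta> \<le> 1 / 2; S \<in> sets borel; S' \<in> sets borel;
        \<And>z :: 'a :: euclidean_space. z \<in> S \<Longrightarrow> 1 - \<delta> < norm z \<and> norm z < 1;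
        \<And>z r. r \<in> {1..1 + \<delta>} \<Longrightarrow> r *\<^sub>R z \<in> S \<Longrightarrow> z \<in> S'\<rbrakk> \<Longrightarrow>
      (\<integral>\<^sup>+ z. ennreal ((1 - (norm z)\<^sup>2) powr \<alpha>) * indicator S z \<partial>lborel)
        \<le> ennreal (K * \<delta> powr \<alpha>) * emeasure lborel S'"
proof -
  (* the Jacobian of a dilation by at most 1 + 1/2 *)
  define c where "c = (3 / 2 :: real) ^ DIM('a)"
  define K1 where "K1 = 2 powr \<bar>\<alpha>\<bar> * (3 / (\<alpha> + 1))"
  have K1: "K1 > 0"
    using \<alpha> by (simp add: K1_def)
  show thesis
  proof (rule that[of "c * K1"])
    show "c * K1 > 0"
      using K1 by (simp add: c_def)
  next
    fix \<delta> :: real and S S' :: "'a set"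
    assume \<delta>: "0 < \<delta>" "\<delta> \<le> 1 / 2" and [measurable]: "S \<in> sets borel" "S' \<in> sets borel"
      and S: "\<And>z. z \<in> S \<Longrightarrow> 1 - \<delta> < norm z \<and> norm z < 1"
      and S': "\<And>z r. r \<in> {1..1 + \<delta>} \<Longrightarrow> r *\<^sub>R z \<in> S \<Longrightarrow> z \<in> S'"
    define h where "h = (\<lambda>z :: 'a. ennreal ((1 - (norm z)\<^sup>2) powr \<alpha>) * indicator S z)"
    have [measurable]: "h \<in> borel_measurable borel"
      unfolding h_def by measurable
    let ?I = "integral\<^sup>N lborel h"
    have hm: "(\<lambda>(r :: real, z). h (r *\<^sub>R z) * indicator {1..1 + \<delta>} r) \<in> borel_measurable (lborel \<Otimes>\<^sub>M lborel)"
      by measurable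
    have "ennreal \<delta> * ?I = (\<integral>\<^sup>+ r. ?I * indicator {1..1 + \<delta>} r \<partial>lborel)"
      using \<delta> by (simp add: nn_integral_cmult mult.commute)
    also have "\<dots> \<le> (\<integral>\<^sup>+ r. ennreal c * (\<integral>\<^sup>+ z. h (r *\<^sub>R z) * indicator {1..1 + \<delta>} r \<partial>lborel) \<partial>lborel)"
    proof (rule nn_integral_mono)
      fix r :: real
      show "?I * indicator {1..1 + \<delta>} r \<le> ennreal c * (\<integral>\<^sup>+ z. h (r *\<^sub>R z) * indicator {1..1 + \<delta>} r \<partial>lborel)"
      proof (cases "r \<in> {1..1 + \<delta>}")
        case True
        then have r: "r > 0" "r \<le> 3 / 2"
          using \<delta> by auto
        have "r ^ DIM('a) \<le> c"
          unfolding c_def using r by (intro power_mono) auto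
        then have "ennreal (r ^ DIM('a)) * (\<integral>\<^sup>+ z. h (r *\<^sub>R z) \<partial>lborel) \<le> ennreal c * (\<integral>\<^sup>+ z. h (r *\<^sub>R z) \<partial>lborel)"
          by (intro mult_right_mono ennreal_leI) auto
        then show ?thesis
          using True r nn_integral_lborel_dilate[of h r] by simp
      qed simp
    qed
    also have "\<dots> = ennreal c * (\<integral>\<^sup>+ r. (\<integral>\<^sup>+ z. h (r *\<^sub>R z) * indicator {1..1 + \<delta>} r \<partial>lborel) \<partial>lborel)"
      by (rule nn_integral_cmult) measurable
    also have "(\<integral>\<^sup>+ r. (\<integral>\<^sup>+ z. h (r *\<^sub>R z) * indicator {1..1 + \<delta>} r \<partial>lborel) \<partial>lborel)
      = (\<integral>\<^sup>+ z. (\<integral>\<^sup>+ r. h (r *\<^sub>R z) * indicator {1..1 + \<delta>} r \<partial>lborel) \<partial>lborel)"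
      by (rule lborel_pair.Fubini'[OF hm, symmetric])
    also have "\<dots> \<le> (\<integral>\<^sup>+ z. ennreal (K1 * \<delta> powr (\<alpha> + 1)) * indicator S' z \<partial>lborel)"
    proof (rule nn_integral_mono)
      fix z :: 'a
      define B where "B = {r \<in> {1..1 + \<delta>}. r *\<^sub>R z \<in> S}"
      show "(\<integral>\<^sup>+ r. h (r *\<^sub>R z) * indicator {1..1 + \<delta>} r \<partial>lborel)
        \<le> ennreal (K1 * \<delta> powr (\<alpha> + 1)) * indicator S' z"
      proof (cases "B = {}")
        case True
        then have *: "h (r *\<^sub>R z) * indicator {1..1 + \<delta>} r = 0" for r
          by (auto simp: B_def h_def indicator_def)
        show ?thesis
          unfolding * by simp
      next
        case False
        then obtain r0 where r0: "r0 \<in> {1..1 + \<delta>}" "r0 *\<^sub>R z \<in> S"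
          by (auto simp: B_def)
        (* z stays away from 0, so the ray through z crosses the shell with positive speed *)
        define \<rho> where "\<rho> = norm z"
        have "1 / 2 < r0 * \<rho>"
          using S[OF r0(2)] r0 \<delta> by (auto simp: \<rho>_def)
        also have "r0 * \<rho> \<le> (3 / 2) * \<rho>"
          using r0 \<delta> by (intro mult_right_mono) (auto simp: \<rho>_def)
        finally have \<rho>: "\<rho> > 1 / 3" by simp
        have "(\<integral>\<^sup>+ r. h (r *\<^sub>R z) * indicator {1..1 + \<delta>} r \<partial>lborel)
          \<le> (\<integral>\<^sup>+ r. ennreal (2 powr \<bar>\<alpha>\<bar>) * (ennreal ((1 - r * \<rho>) powr \<alpha>) * indicator {0..\<delta>} (1 - r * \<rho>)) \<partial>lborel)"
        proof (rule nn_integral_mono)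
          fix r :: real
          show "h (r *\<^sub>R z) * indicator {1..1 + \<delta>} r
            \<le> ennreal (2 powr \<bar>\<alpha>\<bar>) * (ennreal ((1 - r * \<rho>) powr \<alpha>) * indicator {0..\<delta>} (1 - r * \<rho>))"
          proof (cases "r \<in> B")
            case True
            then have r: "r \<in> {1..1 + \<delta>}" "1 - \<delta> < r * \<rho>" "r * \<rho> < 1" "r *\<^sub>R z \<in> S"
              using S[of "r *\<^sub>R z"] by (auto simp: B_def \<rho>_def)
            have "1 - (norm (r *\<^sub>R z))\<^sup>2 = (1 + r * \<rho>) * (1 - r * \<rho>)"
              using r by (simp add: \<rho>_def power2_eq_square algebra_simps)
            then have "(1 - (norm (r *\<^sub>R z))\<^sup>2) powr \<alpha> = (1 + r * \<rho>) powr \<alpha> * (1 - r * \<rho>) powr \<alpha>"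
              using r \<delta> by (simp add: powr_mult)
            also have "\<dots> \<le> 2 powr \<bar>\<alpha>\<bar> * (1 - r * \<rho>) powr \<alpha>"
              using r \<delta> by (intro mult_right_mono powr_abs_bounds(1)) auto
            finally have "ennreal ((1 - (norm (r *\<^sub>R z))\<^sup>2) powr \<alpha>) \<le> ennreal (2 powr \<bar>\<alpha>\<bar> * (1 - r * \<rho>) powr \<alpha>)"
              by (rule ennreal_leI)
            then show ?thesis
              using r by (simp add: h_def ennreal_mult)
          qed (auto simp: B_def h_def indicator_def)
        qed
        also have "\<dots> = ennreal (2 powr \<bar>\<alpha>\<bar>) * ennreal (\<delta> powr (\<alpha> + 1) / ((\<alpha> + 1) * \<rho>))"
          using \<alpha> \<rho> \<delta> by (subst nn_integral_cmult) (simp_all add: nn_integral_powr_le_affine)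
        also have "\<dots> \<le> ennreal (2 powr \<bar>\<alpha>\<bar>) * ennreal (\<delta> powr (\<alpha> + 1) * (3 / (\<alpha> + 1)))"
        proof (intro mult_left_mono ennreal_leI)
          have "1 / \<rho> \<le> 3"
            using \<rho> by (simp add: field_simps)
          then have "\<delta> powr (\<alpha> + 1) / (\<alpha> + 1) * (1 / \<rho>) \<le> \<delta> powr (\<alpha> + 1) / (\<alpha> + 1) * 3"
            using \<alpha> by (intro mult_left_mono) auto
          then show "\<delta> powr (\<alpha> + 1) / ((\<alpha> + 1) * \<rho>) \<le> \<delta> powr (\<alpha> + 1) * (3 / (\<alpha> + 1))"
            by simp
        qed simp
        also have "\<dots> = ennreal (K1 * \<delta> powr (\<alpha> + 1))"
          using \<alpha> by (simp add: K1_def mult_ac flip: ennreal_mult)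
        finally show ?thesis
          using S'[OF r0] by simp
      qed
    qed
    also have "\<dots> = ennreal (K1 * \<delta> powr (\<alpha> + 1)) * emeasure lborel S'"
      by (simp add: nn_integral_cmult)
    also have "ennreal c * (ennreal (K1 * \<delta> powr (\<alpha> + 1)) * emeasure lborel S')
      = ennreal \<delta> * (ennreal (c * K1 * \<delta> powr \<alpha>) * emeasure lborel S')"
    proof -
      have "ennreal c * ennreal (K1 * \<delta> powr (\<alpha> + 1)) = ennreal \<delta> * ennreal (c * K1 * \<delta> powr \<alpha>)"
        using K1 \<delta> by (subst (1 2) ennreal_mult[symmetric]) (auto simp: c_def powr_add mult_ac)
      then show ?thesis
        by (simp only: mult.assoc[symmetric])
    qed
    finally have "ennreal \<delta> * ?I \<le> ennreal \<delta> * (ennreal (c * K1 * \<delta> powr \<alpha>) * emeasure lborel S')"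
      by (simp add: mult_left_mono)
    then have "?I \<le> ennreal (c * K1 * \<delta> powr \<alpha>) * emeasure lborel S'"
      using \<delta> by (simp add: ennreal_mult_le_mult_iff)
    then show "(\<integral>\<^sup>+ z. ennreal ((1 - (norm z)\<^sup>2) powr \<alpha>) * indicator S z \<partial>lborel)
        \<le> ennreal (c * K1 * \<delta> powr \<alpha>) * emeasure lborel S'"
      by (simp add: h_def)
  qed
qed

lemma weighted_ball_finite:
  fixes \<alpha> :: real
  assumes \<alpha>: "\<alpha> > -1"
  shows "(\<integral>\<^sup>+ z. ennreal ((1 - (norm (z :: 'a :: euclidean_space))\<^sup>2) powr \<alpha>) * indicator (ball 0 1) z \<partial>lborel) < \<infinity>"
proof (rule weighted_shell_le[OF \<alpha>, where 'a = 'a], goal_cases)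
  case (1 K)
  note K = 1(2)
  define S :: "'a set" where "S = ball 0 1 - cball 0 (1 / 2)"
  have [measurable]: "S \<in> sets borel" "cball (0 :: 'a) (1 / 2) \<in> sets borel"
    by (auto simp: S_def)
  have "(\<integral>\<^sup>+ z. ennreal ((1 - (norm (z :: 'a))\<^sup>2) powr \<alpha>) * indicator (ball 0 1) z \<partial>lborel)
    \<le> (\<integral>\<^sup>+ z. ennreal ((1 - (norm (z :: 'a))\<^sup>2) powr \<alpha>) * indicator S z
        + ennreal (2 powr \<bar>\<alpha>\<bar>) * indicator (cball 0 (1 / 2)) z \<partial>lborel)"
  proof (rule nn_integral_mono)
    fix z :: 'a
    have "(1 - (norm z)\<^sup>2) powr \<alpha> \<le> 2 powr \<bar>\<alpha>\<bar>" if "norm z \<le> 1 / 2"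
    proof (rule powr_abs_bounds(1))
      have "(norm z)\<^sup>2 \<le> (1 / 2)\<^sup>2"
        using that by (intro power_mono) auto
      then show "1 / 2 \<le> 1 - (norm z)\<^sup>2"
        by (simp add: power2_eq_square)
      show "1 - (norm z)\<^sup>2 \<le> 2"
        using zero_le_power2[of "norm z"] by linarith
    qed simp
    then show "ennreal ((1 - (norm z)\<^sup>2) powr \<alpha>) * indicator (ball 0 1) z
      \<le> ennreal ((1 - (norm z)\<^sup>2) powr \<alpha>) * indicator S z
        + ennreal (2 powr \<bar>\<alpha>\<bar>) * indicator (cball 0 (1 / 2)) z"
      by (auto simp: S_def indicator_def intro: ennreal_leI)
  qed
  also have "\<dots> = (\<integral>\<^sup>+ z. ennreal ((1 - (norm (z :: 'a))\<^sup>2) powr \<alpha>) * indicator S z \<partial>lborel)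
      + ennreal (2 powr \<bar>\<alpha>\<bar>) * emeasure lborel (cball (0 :: 'a) (1 / 2))"
    by (subst nn_integral_add) (auto simp: nn_integral_cmult)
  also have "\<dots> < \<infinity>"
  proof -
    have "(\<integral>\<^sup>+ z. ennreal ((1 - (norm (z :: 'a))\<^sup>2) powr \<alpha>) * indicator S z \<partial>lborel)
      \<le> ennreal (K * (1 / 2) powr \<alpha>) * emeasure lborel (ball (0 :: 'a) 1)"
    proof (rule K)
      fix z :: 'a and r :: real
      assume "r \<in> {1..1 + 1 / 2}" "r *\<^sub>R z \<in> S"
      then have "1 * norm z \<le> r * norm z" "norm (r *\<^sub>R z) < 1" "r > 0"
        using mult_right_mono[of 1 r "norm z"] by (auto simp: S_def simp del: norm_scaleR)
      then show "z \<in> ball 0 1" by simp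
    qed (auto simp: S_def)
    also have "\<dots> < \<infinity>"
      using emeasure_bounded_finite[of "ball (0 :: 'a) 1"] by (simp add: ennreal_mult_less_top)
    finally show ?thesis
      using emeasure_bounded_finite[of "cball (0 :: 'a) (1 / 2)"] by (simp add: ennreal_mult_less_top)
  qed
  finally show ?thesis .
qed

lemma nn_integral_lebesgue_on_lborel:
  assumes "S \<in> sets borel"
  shows "(\<integral>\<^sup>+ z. g z \<partial>lebesgue_on S) = (\<integral>\<^sup>+ z. g z * indicator S z \<partial>lborel)"
proof -
  have "S \<in> sets lebesgue"
    using assms by auto
  then show ?thesis
    by (subst nn_integral_restrict_space) (auto simp: nn_integral_completion)
qed

text \<open>The Bochner integral in the definition is \<open>0\<close> for a function that is not integrable, so positivity of
the constant rests on the finiteness of the mass.\<close>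

lemma bergman_const_pos:
  assumes \<alpha>: "\<alpha> > -1"
  shows "bergman_const TYPE('n::finite) \<alpha> > 0"
proof -
  let ?f = "\<lambda>z :: complex ^ 'n. (1 - (norm z)\<^sup>2) powr \<alpha>"
  let ?J = "\<integral>\<^sup>+ z. ennreal (?f z) * indicator (ball 0 1) z \<partial>lborel"
  have "?f \<in> borel_measurable lborel"
    by measurable
  then have "?f \<in> borel_measurable (lebesgue_on (ball 0 1))"
    by (simp add: borel_measurable_if_I measurable_completion measurable_restrict_space1)
  then have "(LINT z|lebesgue_on (ball 0 1). ?f z) = enn2real (\<integral>\<^sup>+ z. ennreal (?f z) \<partial>lebesgue_on (ball 0 1))"
    by (intro integral_eq_nn_integral) auto
  then have eq: "(LINT z|lebesgue_on (ball 0 1). ?f z) = enn2real ?J"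
    by (simp add: nn_integral_lebesgue_on_lborel)
  have "ennreal (2 powr (- \<bar>\<alpha>\<bar>)) * emeasure lborel (cball (0 :: complex ^ 'n) (1 / 2))
    = (\<integral>\<^sup>+ z. ennreal (2 powr (- \<bar>\<alpha>\<bar>)) * indicator (cball (0 :: complex ^ 'n) (1 / 2)) z \<partial>lborel)"
    by (subst nn_integral_cmult_indicator) auto
  also have "\<dots> \<le> ?J"
  proof (rule nn_integral_mono)
    fix z :: "complex ^ 'n"
    have "2 powr (- \<bar>\<alpha>\<bar>) \<le> ?f z" if "norm z \<le> 1 / 2"
    proof (rule powr_abs_bounds(2))
      have "(norm z)\<^sup>2 \<le> (1 / 2)\<^sup>2"
        using that by (intro power_mono) auto
      then show "1 / 2 \<le> 1 - (norm z)\<^sup>2"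
        by (simp add: power2_eq_square)
      show "1 - (norm z)\<^sup>2 \<le> 2"
        using zero_le_power2[of "norm z"] by linarith
    qed simp
    then show "ennreal (2 powr (- \<bar>\<alpha>\<bar>)) * indicator (cball 0 (1 / 2)) z \<le> ennreal (?f z) * indicator (ball 0 1) z"
      by (auto simp: indicator_def intro: ennreal_leI)
  qed
  finally have "?J \<noteq> 0"
    using content_cball_pos[of "1 / 2" "0 :: complex ^ 'n"]
      emeasure_bounded_finite[of "cball (0 :: complex ^ 'n) (1 / 2)"]
    by (auto simp: emeasure_eq_ennreal_measure)
  moreover have "?J < \<infinity>"
    by (rule weighted_ball_finite[OF \<alpha>])
  ultimately have "enn2real ?J > 0"
    by (simp add: enn2real_positive_iff zero_less_iff_neq_zero)
  then show ?thesis
    unfolding bergman_const_def eq by simp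
qed


lemma nn_integral_bergman_measure:
  fixes g :: "complex ^ 'n \<Rightarrow> ennreal"
  assumes "(\<lambda>z. g z * indicator (ball 0 1) z) \<in> borel_measurable borel" and \<alpha>: "\<alpha> > -1"
  shows "(\<integral>\<^sup>+ z. g z \<partial>bergman_measure \<alpha>) = ennreal (bergman_const TYPE('n) \<alpha>) *
    (\<integral>\<^sup>+ z. ennreal ((1 - (norm z)\<^sup>2) powr \<alpha>) * (g z * indicator (ball 0 1) z) \<partial>lborel)"
proof -
  let ?c = "bergman_const TYPE('n) \<alpha>" and ?L = "lebesgue_on (ball (0 :: complex ^ 'n) 1)"
  have "(\<lambda>z. g z * indicator (ball 0 1) z) \<in> borel_measurable lebesgue"
    using assms(1) by (simp add: measurable_completion)
  then have g: "g \<in> borel_measurable ?L"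
    by (subst borel_measurable_restrict_space_iff_ennreal) (auto simp: mult.commute)
  have w: "(\<lambda>z :: complex ^ 'n. ennreal (?c * (1 - (norm z)\<^sup>2) powr \<alpha>)) \<in> borel_measurable borel"
    by measurable
  then have w': "(\<lambda>z. ennreal (?c * (1 - (norm z)\<^sup>2) powr \<alpha>)) \<in> borel_measurable ?L"
    by (intro measurable_restrict_space1 measurable_completion) simp
  have "(\<integral>\<^sup>+ z. g z \<partial>bergman_measure \<alpha>)
    = (\<integral>\<^sup>+ z. ennreal (?c * (1 - (norm z)\<^sup>2) powr \<alpha>) * g z * indicator (ball 0 1) z \<partial>lborel)"
    unfolding bergman_measure_def
    by (subst nn_integral_density[OF w' g]) (simp add: nn_integral_lebesgue_on_lborel)
  also have "\<dots> = (\<integral>\<^sup>+ z. ennreal ?c * (ennreal ((1 - (norm z)\<^sup>2) powr \<alpha>) * (g z * indicator (ball 0 1) z)) \<partial>lborel)"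
    using bergman_const_pos[OF \<alpha>, where 'n='n] by (simp add: ennreal_mult mult.assoc)
  also have "\<dots> = ennreal ?c * (\<integral>\<^sup>+ z. ennreal ((1 - (norm z)\<^sup>2) powr \<alpha>) * (g z * indicator (ball 0 1) z) \<partial>lborel)"
    by (rule nn_integral_cmult, rule borel_measurable_times_ennreal) (use assms(1) in simp_all)
  finally show ?thesis .
qed

lemma space_bergman_measure [simp]: "space (bergman_measure \<alpha>) = ball 0 1"
  by (simp add: bergman_measure_def space_restrict_space)

lemma sets_bergman_measure [measurable_cong]: "sets (bergman_measure \<alpha>) = sets (lebesgue_on (ball 0 1))"
  by (simp add: bergman_measure_def)

lemma borel_subset_in_sets_bergman:
  assumes "S \<in> sets borel" "S \<subseteq> ball 0 1"
  shows "S \<in> sets (bergman_measure \<alpha>)"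
  using assms by (auto simp: sets_bergman_measure sets_restrict_space_iff)

lemma emeasure_bergman_measure:
  assumes S: "S \<in> sets borel" "S \<subseteq> ball (0 :: complex ^ 'n) 1" and \<alpha>: "\<alpha> > -1"
  shows "emeasure (bergman_measure \<alpha>) S = ennreal (bergman_const TYPE('n) \<alpha>) *
    (\<integral>\<^sup>+ z. ennreal ((1 - (norm z)\<^sup>2) powr \<alpha>) * indicator S z \<partial>lborel)"
proof -
  have eq: "indicator S z * indicator (ball 0 1) z = (indicator S z :: ennreal)" for z
    using S by (auto simp: indicator_def)
  have "emeasure (bergman_measure \<alpha>) S = (\<integral>\<^sup>+ z. indicator S z \<partial>bergman_measure \<alpha>)"
    using borel_subset_in_sets_bergman[OF S] by simp
  also have "\<dots> = ennreal (bergman_const TYPE('n) \<alpha>) *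
    (\<integral>\<^sup>+ z. ennreal ((1 - (norm z)\<^sup>2) powr \<alpha>) * indicator S z \<partial>lborel)"
    using S by (subst nn_integral_bergman_measure[OF _ \<alpha>]) (simp_all add: eq)
  finally show ?thesis .
qed

lemma emeasure_bergman_ball_finite:
  assumes \<alpha>: "\<alpha> > -1"
  shows "emeasure (bergman_measure \<alpha>) (ball (0 :: complex ^ 'n) 1) < \<infinity>"
  using weighted_ball_finite[OF \<alpha>, where 'a = "complex ^ 'n"]
  by (subst emeasure_bergman_measure[OF _ _ \<alpha>]) (auto simp: ennreal_mult_less_top)

section \<open>Volume of boundary caps\<close>

lemma parabolic_coordinates:
  assumes e: "norm e = 1"
  defines "b v \<equiv> v - herm v e *s e"
  shows "(norm v)\<^sup>2 = (norm (herm v e))\<^sup>2 + (norm (b v))\<^sup>2"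
    and "(norm (a *\<^sub>R e + parabolic t e v))\<^sup>2 = (norm (of_real a + of_real (t\<^sup>2) * herm v e))\<^sup>2 + t\<^sup>2 * (norm (b v))\<^sup>2"
    and "herm (a *\<^sub>R e + parabolic t e v) e = of_real a + of_real (t\<^sup>2) * herm v e"
proof -
  have b: "herm (b v) e = 0" "herm (t *\<^sub>R b v) e = 0"
    using e by (simp_all add: b_def herm_diff_left herm_smult_left herm_scaleR_left herm_self)
  have "v = herm v e *s e + b v"
    by (simp add: b_def)
  then show "(norm v)\<^sup>2 = (norm (herm v e))\<^sup>2 + (norm (b v))\<^sup>2"
    using norm_add_orthogonal_sq[OF b(1) e, of "herm v e"] by simp
  have "a *\<^sub>R e + parabolic t e v = (of_real a + of_real (t\<^sup>2) * herm v e) *s e + t *\<^sub>R b v"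
    by (simp add: b_def parabolic_def scaleR_eq_smult vec_eq_iff algebra_simps)
  then show "(norm (a *\<^sub>R e + parabolic t e v))\<^sup>2
      = (norm (of_real a + of_real (t\<^sup>2) * herm v e))\<^sup>2 + t\<^sup>2 * (norm (b v))\<^sup>2"
    using norm_add_orthogonal_sq[OF b(2) e, of "of_real a + of_real (t\<^sup>2) * herm v e"]
    by (simp add: power_mult_distrib)
  show "herm (a *\<^sub>R e + parabolic t e v) e = of_real a + of_real (t\<^sup>2) * herm v e"
    using e by (simp add: herm_add_left herm_scaleR_left herm_self herm_parabolic)
qed

text \<open>For a unit vector \<open>e\<close> and \<open>\<tau> < 1\<close> this is the Carleson tent over \<open>(1 - \<tau>) e\<close>. The parameter is not
restricted to \<open>\<tau> < 1\<close> because the caps also serve as the level sets of \<open>|1 - \<langle>z, e\<rangle>|\<close> on the whole ball.\<close>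

definition cap :: "complex ^ 'n \<Rightarrow> real \<Rightarrow> (complex ^ 'n) set" where
  "cap e \<tau> = {z \<in> ball 0 1. norm (1 - herm z e) < \<tau>}"

lemma borel_cap [measurable]: "cap e \<tau> \<in> sets borel"
proof -
  have "open (ball 0 1 \<inter> (\<lambda>z. norm (1 - herm z e)) -` {..<\<tau>})"
    by (intro continuous_open_preimage continuous_intros) auto
  also have "ball 0 1 \<inter> (\<lambda>z. norm (1 - herm z e)) -` {..<\<tau>} = cap e \<tau>"
    by (auto simp: cap_def)
  finally show ?thesis by simp
qed

lemma cap_subset_ball: "cap e \<tau> \<subseteq> ball 0 1"
  by (auto simp: cap_def)

text \<open>The cap lies in the image of the ball of radius \<open>2\<close> under the affine map
\<open>v \<mapsto> e + parabolic t e v\<close> with \<open>t\<^sup>2 = \<tau>\<close>.\<close>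

lemma volume_cap_le:
  fixes e :: "complex ^ 'n"
  assumes e: "norm e = 1" and \<tau>: "\<tau> > 0"
  shows "emeasure lborel (cap e \<tau>) \<le> ennreal (\<tau> ^ (CARD('n) + 1)) * emeasure lborel (ball (0 :: complex ^ 'n) 2)"
proof -
  define t where "t = sqrt \<tau>"
  have t: "t > 0" "t\<^sup>2 = \<tau>"
    using \<tau> by (auto simp: t_def)
  have "emeasure lborel (cap e \<tau>) = (\<integral>\<^sup>+ z. indicator (cap e \<tau>) z \<partial>lborel)"
    by simp
  also have "\<dots> = (\<integral>\<^sup>+ z. indicator (cap e \<tau>) (e + z) \<partial>lborel)"
    by (subst nn_integral_lborel_shift) auto
  also have "\<dots> = ennreal (t ^ (2 * CARD('n) + 2)) * (\<integral>\<^sup>+ v. indicator (cap e \<tau>) (e + parabolic t e v) \<partial>lborel)"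
    by (rule nn_integral_lborel_parabolic) (use t e in auto)
  also have "\<dots> \<le> ennreal (t ^ (2 * CARD('n) + 2)) * (\<integral>\<^sup>+ v. indicator (ball (0 :: complex ^ 'n) 2) v \<partial>lborel)"
  proof (intro mult_left_mono nn_integral_mono)
    fix v :: "complex ^ 'n"
    show "indicator (cap e \<tau>) (e + parabolic t e v) \<le> (indicator (ball 0 2) v :: ennreal)"
    proof (cases "e + parabolic t e v \<in> cap e \<tau>")
      case True
      define h where "h = herm v e"
      define b where "b = norm (v - h *s e)"
      have 1: "(norm v)\<^sup>2 = (norm h)\<^sup>2 + b\<^sup>2"
        "(norm (e + parabolic t e v))\<^sup>2 = (norm (1 + of_real \<tau> * h))\<^sup>2 + \<tau> * b\<^sup>2"
        "herm (e + parabolic t e v) e = 1 + of_real \<tau> * h"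
        using parabolic_coordinates(1)[OF e, of v] parabolic_coordinates(2,3)[OF e, of 1 t v]
        by (simp_all add: h_def b_def t)
      have "norm (of_real \<tau> * h) < \<tau>"
        using True by (simp add: cap_def 1)
      then have h: "norm h < 1"
        using \<tau> by (simp add: norm_mult)
      have "(norm (e + parabolic t e v))\<^sup>2 < 1\<^sup>2"
        using True by (intro power_strict_mono) (auto simp: cap_def)
      moreover have "(norm (1 + of_real \<tau> * h))\<^sup>2 \<ge> 1 + 2 * \<tau> * Re h"
        unfolding cmod_power2 using zero_le_square[of "\<tau> * Re h"] zero_le_square[of "\<tau> * Im h"]
        by (simp add: power2_eq_square algebra_simps)
      moreover have "Re h \<ge> -1"
        using h abs_Re_le_cmod[of h] by linarith
      then have "\<tau> * Re h \<ge> \<tau> * (-1)"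
        using \<tau> by (intro mult_left_mono) auto
      ultimately have "\<tau> * b\<^sup>2 < \<tau> * 2"
        unfolding 1 power_one by linarith
      then have "b\<^sup>2 < 2"
        using \<tau> by simp
      moreover have "(norm h)\<^sup>2 < 1\<^sup>2"
        using h by (intro power_strict_mono) auto
      ultimately have "(norm v)\<^sup>2 < 2\<^sup>2"
        unfolding 1 by simp
      then have "norm v < 2"
        by (rule power2_less_imp_less) simp
      then show ?thesis
        by (simp add: indicator_def)
    qed simp
  qed simp
  also have "t ^ (2 * CARD('n) + 2) = \<tau> ^ (CARD('n) + 1)"
    by (simp add: t(2)[symmetric] flip: power_mult power_Suc)
  finally show ?thesis
    by simp
qed

text \<open>A cap of size \<open>\<tau> \<le> 1/2\<close> is contained in the shell \<open>1 - \<tau> < |z| < 1\<close>, and shrinking it by factors up to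
\<open>1 + \<tau>\<close> keeps it inside the cap of size \<open>2 \<tau>\<close>; so the shell estimate applies. For larger \<open>\<tau>\<close> the total
mass is a sufficient bound.\<close>

lemma emeasure_cap_le:
  assumes \<alpha>: "\<alpha> > -1"
  obtains C where "C > 0"
    "\<And>(e :: complex ^ 'n) \<tau>. norm e = 1 \<Longrightarrow> \<tau> > 0 \<Longrightarrow>
      emeasure (bergman_measure \<alpha>) (cap e \<tau>) \<le> ennreal (C * \<tau> powr (\<alpha> + real CARD('n) + 1))"
proof (rule weighted_shell_le[OF \<alpha>, where 'a = "complex ^ 'n"], goal_cases)
  case (1 K)
  note K = this
  define m where "m = \<alpha> + real CARD('n) + 1"
  have m: "m > 0"
    using \<alpha> by (simp add: m_def)
  define c where "c = bergman_const TYPE('n) \<alpha>"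
  have c: "c > 0"
    unfolding c_def by (rule bergman_const_pos[OF \<alpha>])
  define vol where "vol = measure lborel (ball (0 :: complex ^ 'n) 2)"
  have vol: "vol \<ge> 0" "emeasure lborel (ball (0 :: complex ^ 'n) 2) = ennreal vol"
    using emeasure_bounded_finite[of "ball (0 :: complex ^ 'n) 2"]
    by (auto simp: vol_def emeasure_eq_ennreal_measure)
  define V where "V = measure (bergman_measure \<alpha>) (ball (0 :: complex ^ 'n) 1)"
  have V: "V \<ge> 0" "emeasure (bergman_measure \<alpha>) (ball (0 :: complex ^ 'n) 1) = ennreal V"
    using emeasure_bergman_ball_finite[OF \<alpha>, where 'n = 'n]
    by (auto simp: V_def emeasure_eq_ennreal_measure)
  define A where "A = c * K * 2 ^ (CARD('n) + 1) * vol"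
  define C where "C = A + V * 2 powr m + 1"
  have A: "A \<ge> 0"
    using c K vol by (simp add: A_def)
  show thesis
  proof (rule that[of C])
    show "C > 0"
      using A V by (simp add: C_def add_nonneg_pos)
    fix e :: "complex ^ 'n" and \<tau> :: real
    assume e: "norm e = 1" and \<tau>: "\<tau> > 0"
    show "emeasure (bergman_measure \<alpha>) (cap e \<tau>) \<le> ennreal (C * \<tau> powr (\<alpha> + real CARD('n) + 1))"
    proof (cases "\<tau> \<le> 1 / 2")
      case True
      have "emeasure (bergman_measure \<alpha>) (cap e \<tau>)
        = ennreal c * (\<integral>\<^sup>+ z. ennreal ((1 - (norm z)\<^sup>2) powr \<alpha>) * indicator (cap e \<tau>) z \<partial>lborel)"
        unfolding c_def by (rule emeasure_bergman_measure[OF borel_cap cap_subset_ball \<alpha>])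
      also have "\<dots> \<le> ennreal c * (ennreal (K * \<tau> powr \<alpha>) * emeasure lborel (cap e (2 * \<tau>)))"
      proof (intro mult_left_mono K)
        fix z
        assume z: "z \<in> cap e \<tau>"
        have "norm (herm z e) \<le> norm z"
          using norm_herm_le[of z e] e by simp
        then have "1 - norm (1 - herm z e) \<le> norm z"
          using norm_triangle_ineq[of "herm z e" "1 - herm z e"] by simp
        then show "1 - \<tau> < norm z \<and> norm z < 1"
          using z by (auto simp: cap_def)
      next
        fix z and r :: real
        assume r: "r \<in> {1..1 + \<tau>}" and z: "r *\<^sub>R z \<in> cap e \<tau>"
        have "1 * norm z \<le> r * norm z"
          using r by (intro mult_right_mono) auto
        then have nz: "norm z < 1"
          using z r by (auto simp: cap_def)
        have "norm (1 - herm z e) = norm ((1 - herm (r *\<^sub>R z) e) + of_real (r - 1) * herm z e)"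
          by (simp add: herm_scaleR_left algebra_simps)
        also have "\<dots> \<le> norm (1 - herm (r *\<^sub>R z) e) + norm (of_real (r - 1) * herm z e)"
          by (rule norm_triangle_ineq)
        also have "norm (of_real (r - 1) * herm z e) \<le> \<tau> * 1"
          unfolding norm_mult
        proof (rule mult_mono)
          show "norm (complex_of_real (r - 1)) \<le> \<tau>"
            unfolding norm_of_real using r by simp
          show "norm (herm z e) \<le> 1"
            using norm_herm_le[of z e] e nz by simp
        qed (use \<tau> in auto)
        also have "norm (1 - herm (r *\<^sub>R z) e) < \<tau>"
          using z by (simp add: cap_def)
        finally show "z \<in> cap e (2 * \<tau>)"
          using nz by (simp add: cap_def)
      qed (use \<tau> True in auto)
      also have "\<dots> \<le> ennreal c * (ennreal (K * \<tau> powr \<alpha>) * (ennreal ((2 * \<tau>) ^ (CARD('n) + 1)) * ennreal vol))"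
        using volume_cap_le[OF e, of "2 * \<tau>"] \<tau> vol by (intro mult_left_mono) auto
      also have "\<dots> = ennreal (c * (K * \<tau> powr \<alpha> * ((2 * \<tau>) ^ (CARD('n) + 1) * vol)))"
        using c K \<tau> vol by (simp add: ennreal_mult)
      also have "c * (K * \<tau> powr \<alpha> * ((2 * \<tau>) ^ (CARD('n) + 1) * vol)) = A * \<tau> powr m"
      proof -
        have "\<tau> powr m = \<tau> powr \<alpha> * \<tau> powr real (CARD('n) + 1)"
          unfolding powr_add[symmetric] by (simp add: m_def add_ac)
        also have "\<tau> powr real (CARD('n) + 1) = \<tau> ^ (CARD('n) + 1)"
          using \<tau> by (rule powr_realpow)
        finally show ?thesis
          by (simp only: A_def power_mult_distrib mult_ac)
      qed
      also have "ennreal (A * \<tau> powr m) \<le> ennreal (C * \<tau> powr m)"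
        using V by (intro ennreal_leI mult_right_mono) (auto simp: C_def)
      finally show ?thesis
        by (simp add: m_def)
    next
      case False
      have "emeasure (bergman_measure \<alpha>) (cap e \<tau>) \<le> ennreal V"
        unfolding V(2)[symmetric]
        by (rule emeasure_mono[OF cap_subset_ball borel_subset_in_sets_bergman]) auto
      also have "\<dots> \<le> ennreal (C * \<tau> powr m)"
      proof (rule ennreal_leI)
        have "1 \<le> (2 * \<tau>) powr m"
          using False m by (intro ge_one_powr_ge_zero) auto
        then have "V * 1 \<le> V * (2 * \<tau>) powr m"
          using V by (intro mult_left_mono) auto
        also have "\<dots> = V * 2 powr m * \<tau> powr m"
          using \<tau> by (simp add: powr_mult)
        also have "\<dots> \<le> C * \<tau> powr m"
          using A by (intro mult_right_mono) (auto simp: C_def)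
        finally show "V \<le> C * \<tau> powr m"
          by simp
      qed
      finally show ?thesis
        by (simp add: m_def)
    qed
  qed
qed

section \<open>Pointwise estimates for holomorphic functions\<close>

text \<open>In the coordinates \<open>v = h e + b\<close>, with \<open>b\<close> orthogonal to \<open>e\<close>, the scaling changes \<open>1 - |w|\<^sup>2\<close> by at most
\<open>3 t\<^sup>2\<close>. The choice \<open>t\<^sup>2 = \<delta> / 6\<close> makes this half of \<open>\<delta>\<close>.\<close>

lemma parabolic_box:
  fixes w e :: "complex ^ 'n"
  assumes e: "norm e = 1" and w: "w = norm w *\<^sub>R e" "norm w < 1" and v: "v \<in> ball 0 1"
  defines "\<delta> \<equiv> 1 - norm w"
  defines "z \<equiv> w + parabolic (sqrt (\<delta> / 6)) e v"
  shows "\<delta> / 2 \<le> 1 - (norm z)\<^sup>2" "1 - (norm z)\<^sup>2 \<le> 3 * \<delta>" "norm (1 - herm z w) \<le> 3 * \<delta>"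
proof -
  define r where "r = norm w"
  define T where "T = \<delta> / 6"
  define h where "h = herm v e"
  define b where "b = norm (v - h *s e)"
  have d: "0 < \<delta>" "\<delta> \<le> 1" "r = 1 - \<delta>" "0 \<le> r"
    using w(2) by (auto simp: \<delta>_def r_def)
  have T: "0 < T" "T \<le> 1" "(sqrt T)\<^sup>2 = T"
    using d by (auto simp: T_def)
  have wr: "w = r *\<^sub>R e"
    using w(1) by (simp add: r_def)
  have z: "z = r *\<^sub>R e + parabolic (sqrt T) e v"
    unfolding z_def T_def[symmetric] wr[symmetric] ..
  have 1: "(norm v)\<^sup>2 = (norm h)\<^sup>2 + b\<^sup>2"
    "(norm z)\<^sup>2 = (norm (of_real r + of_real T * h))\<^sup>2 + T * b\<^sup>2"
    "herm z e = of_real r + of_real T * h"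
    using parabolic_coordinates(1)[OF e, of v] parabolic_coordinates(2,3)[OF e, of r "sqrt T" v]
    unfolding z h_def b_def T(3) by simp_all
  have "(norm v)\<^sup>2 < 1\<^sup>2"
    using v by (intro power_strict_mono) auto
  then have hb: "(norm h)\<^sup>2 + b\<^sup>2 < 1"
    by (simp add: 1)
  then have "(norm h)\<^sup>2 \<le> 1\<^sup>2"
    using zero_le_power2[of b] unfolding power_one by linarith
  then have h: "norm h \<le> 1"
    by (rule power2_le_imp_le) simp
  have "(norm (of_real r + of_real T * h))\<^sup>2 = r\<^sup>2 + 2 * (r * (T * Re h)) + T\<^sup>2 * (norm h)\<^sup>2"
    unfolding cmod_power2 by (simp add: power2_eq_square algebra_simps)
  then have z2: "(norm z)\<^sup>2 = r\<^sup>2 + 2 * (r * (T * Re h)) + T\<^sup>2 * (norm h)\<^sup>2 + T * b\<^sup>2"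
    by (simp add: 1)
  have reh: "\<bar>r * (T * Re h)\<bar> \<le> 1 * (T * 1)"
    unfolding abs_mult using d T h abs_Re_le_cmod[of h] by (intro mult_mono) auto
  have "T\<^sup>2 * (norm h)\<^sup>2 \<le> T * (norm h)\<^sup>2"
    using T by (intro mult_right_mono) (auto simp: power2_eq_square mult_le_one)
  moreover have "T * ((norm h)\<^sup>2 + b\<^sup>2) \<le> T * 1"
    using T hb by (intro mult_left_mono) auto
  ultimately have up: "T\<^sup>2 * (norm h)\<^sup>2 + T * b\<^sup>2 \<le> T"
    by (simp add: distrib_left)
  have lo: "0 \<le> T\<^sup>2 * (norm h)\<^sup>2 + T * b\<^sup>2"
    using T by simp
  have r2: "1 - r\<^sup>2 = 2 * \<delta> - \<delta>\<^sup>2"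
    by (simp add: d(3) power2_eq_square algebra_simps)
  have d2: "\<delta>\<^sup>2 \<le> \<delta>" "0 \<le> \<delta>\<^sup>2"
    using d by (auto simp: power2_eq_square mult_le_one)
  show "\<delta> / 2 \<le> 1 - (norm z)\<^sup>2"
    using z2 reh up r2 d2 T_def by linarith
  show "1 - (norm z)\<^sup>2 \<le> 3 * \<delta>"
    using z2 reh lo r2 d2 T_def d by linarith
  have "1 - herm z w = of_real (1 - r\<^sup>2) - of_real r * (of_real T * h)"
    by (subst wr) (simp add: herm_scaleR_right 1 power2_eq_square algebra_simps)
  also have "norm \<dots> \<le> norm (complex_of_real (1 - r\<^sup>2)) + norm (of_real r * (of_real T * h))"
    by (rule norm_triangle_ineq4)
  also have "norm (complex_of_real (1 - r\<^sup>2)) = 1 - r\<^sup>2"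
    unfolding norm_of_real using r2 d2 d by linarith
  also have "norm (of_real r * (of_real T * h)) \<le> 1 * (T * 1)"
    unfolding norm_mult norm_of_real using d T h by (intro mult_mono) auto
  finally show "norm (1 - herm z w) \<le> 3 * \<delta>"
    using r2 d2 T_def d by linarith
qed

text \<open>The points where \<open>|1 - \<langle>z, w\<rangle>|\<close> is within a factor \<open>3\<close> of its infimum \<open>1 - |w|\<close> over the ball. The set contains the image of the unit ball under the parabolic scaling about \<open>w\<close>.\<close>

definition kernel_nbhd :: "complex ^ 'n \<Rightarrow> (complex ^ 'n) set" where
  "kernel_nbhd w = {z \<in> ball 0 1. norm (1 - herm z w) \<le> 3 * (1 - norm w)}"

lemma borel_kernel_nbhd [measurable]: "kernel_nbhd w \<in> sets borel"
proof -
  have "closed {z. norm (1 - herm z w) \<le> 3 * (1 - norm w)}"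
    by (intro closed_Collect_le continuous_intros)
  then have "ball 0 1 \<inter> {z. norm (1 - herm z w) \<le> 3 * (1 - norm w)} \<in> sets borel"
    by (intro sets.Int) auto
  also have "ball 0 1 \<inter> {z. norm (1 - herm z w) \<le> 3 * (1 - norm w)} = kernel_nbhd w"
    by (auto simp: kernel_nbhd_def)
  finally show ?thesis .
qed

lemma kernel_nbhd_subset_ball: "kernel_nbhd w \<subseteq> ball 0 1"
  by (auto simp: kernel_nbhd_def)

lemma obtain_direction:
  fixes w :: "complex ^ 'n"
  obtains e where "norm e = 1" "w = norm w *\<^sub>R e"
proof (cases "w = 0")
  case True
  obtain e :: "complex ^ 'n" where "norm e = 1"
    using norm_Basis nonempty_Basis by blast
  then show thesis
    using True that by simp
next
  case False
  then show thesis
    by (intro that[of "w /\<^sub>R norm w"]) auto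
qed

text \<open>Apply the mean value inequality to the parabolic scaling about \<open>w\<close>. Its Jacobian is of order
\<open>\<delta>\<^bsup>n+1\<^esup>\<close> for \<open>\<delta> = 1 - |w|\<close>, and the weight is of order \<open>\<delta>\<^sup>\<alpha>\<close> on the image, for either sign of
\<open>\<alpha>\<close>.\<close>

lemma holo_pointwise_le:
  assumes \<alpha>: "\<alpha> > -1" and q: "q > 1"
  obtains C where "C > 0"
    "\<And>(f :: complex ^ 'n \<Rightarrow> complex) w. holo_on f (ball 0 1) \<Longrightarrow> w \<in> ball 0 1 \<Longrightarrow>
      ennreal (norm (f w) powr q) \<le> ennreal (C * (1 - norm w) powr (- (\<alpha> + real CARD('n) + 1))) *
        (\<integral>\<^sup>+ z. ennreal (norm (f z) powr q) * indicator (kernel_nbhd w) z \<partial>bergman_measure \<alpha>)"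
proof -
  define c where "c = bergman_const TYPE('n) \<alpha>"
  have c: "c > 0"
    unfolding c_def by (rule bergman_const_pos[OF \<alpha>])
  define vol where "vol = measure lborel (ball (0 :: complex ^ 'n) 1)"
  have vol: "vol > 0" "emeasure lborel (ball (0 :: complex ^ 'n) 1) = ennreal vol"
    using emeasure_bounded_finite[of "ball (0 :: complex ^ 'n) 1"] content_ball_pos[of 1 "0 :: complex ^ 'n"]
    by (auto simp: vol_def emeasure_eq_ennreal_measure)
  define N where "N = CARD('n) + 1"
  define K where "K = (3 :: real) powr \<bar>\<alpha>\<bar>"
  have K: "K > 0"
    by (simp add: K_def)
  show thesis
  proof (rule that[of "K * 6 ^ N / (c * vol)"])
    show "K * 6 ^ N / (c * vol) > 0"
      using c vol K by simp
    fix f :: "complex ^ 'n \<Rightarrow> complex" and w :: "complex ^ 'n"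
    assume f: "holo_on f (ball 0 1)" and "w \<in> ball 0 1"
    then have nw: "norm w < 1" by simp
    obtain e where e: "norm e = 1" "w = norm w *\<^sub>R e"
      by (rule obtain_direction)
    define \<delta> where "\<delta> = 1 - norm w"
    define t where "t = sqrt (\<delta> / 6)"
    have \<delta>: "\<delta> > 0" and t: "t > 0" "t\<^sup>2 = \<delta> / 6"
      using nw by (auto simp: \<delta>_def t_def)
    note box = parabolic_box[OF e nw, folded \<delta>_def, folded t_def]
    define X where "X = ennreal (norm (f w) powr q)"
    define J where "J = (\<integral>\<^sup>+ z. ennreal (norm (f z) powr q) * indicator (kernel_nbhd w) z \<partial>bergman_measure \<alpha>)"
    define F where "F = (\<lambda>z. ennreal (norm (f z) powr q) * indicator (kernel_nbhd w) z)"
    have F: "F \<in> borel_measurable borel"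
    proof -
      have "continuous_on (ball 0 1) (\<lambda>z. norm (f z) powr q)"
        using q by (intro continuous_on_powr' continuous_intros holo_on_continuous f) auto
      then have "(\<lambda>z. indicator (ball 0 1) z *\<^sub>R (norm (f z) powr q)) \<in> borel_measurable borel"
        by (intro borel_measurable_continuous_on_indicator) auto
      then have "(\<lambda>z. ennreal (indicator (ball 0 1) z *\<^sub>R (norm (f z) powr q)) * indicator (kernel_nbhd w) z) \<in> borel_measurable borel"
        by measurable
      also have "(\<lambda>z. ennreal (indicator (ball 0 1) z *\<^sub>R (norm (f z) powr q)) * indicator (kernel_nbhd w) z) = F"
        by (auto simp: F_def kernel_nbhd_def indicator_def fun_eq_iff)
      finally show ?thesis .
    qed
    define G where "G = (\<lambda>z. ennreal ((1 - (norm z)\<^sup>2) powr \<alpha>) * F z)"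
    have [measurable]: "G \<in> borel_measurable borel"
      unfolding G_def using F by measurable
    have Fb: "F z * indicator (ball 0 1) z = F z" for z
      by (auto simp: F_def kernel_nbhd_def indicator_def)
    have J: "J = ennreal c * (\<integral>\<^sup>+ z. G z \<partial>lborel)"
      unfolding J_def c_def F_def[symmetric]
      by (subst nn_integral_bergman_measure[OF _ \<alpha>]) (simp_all add: Fb F G_def)
    have "X * ennreal vol \<le> (\<integral>\<^sup>+ v. ennreal (norm (f (w + parabolic t e v)) powr q) * indicator (ball 0 1) v \<partial>lborel)"
      unfolding X_def vol(2)[symmetric]
    proof (rule mean_value_parabolic[OF f q])
      fix v :: "complex ^ 'n"
      assume v: "v \<in> ball 0 1"
      have "(norm (w + parabolic t e v))\<^sup>2 < 1\<^sup>2"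
        using box(1)[OF v] \<delta> unfolding power_one by linarith
      then have "norm (w + parabolic t e v) < 1"
        by (rule power2_less_imp_less) simp
      then show "w + parabolic t e v \<in> ball 0 1"
        by simp
    qed
    also have "\<dots> \<le> (\<integral>\<^sup>+ v. ennreal (K * \<delta> powr (- \<alpha>)) * G (w + parabolic t e v) \<partial>lborel)"
    proof (rule nn_integral_mono)
      fix v :: "complex ^ 'n"
      define z where "z = w + parabolic t e v"
      show "ennreal (norm (f (w + parabolic t e v)) powr q) * indicator (ball 0 1) v
        \<le> ennreal (K * \<delta> powr (- \<alpha>)) * G (w + parabolic t e v)"
        unfolding z_def[symmetric]
      proof (cases "v \<in> ball 0 1")
        case True
        note bz = box[OF True, folded z_def]
        have "(norm z)\<^sup>2 < 1\<^sup>2"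
          using bz(1) \<delta> unfolding power_one by linarith
        then have "norm z < 1"
          by (rule power2_less_imp_less) simp
        then have "z \<in> kernel_nbhd w"
          using bz(3) by (simp add: kernel_nbhd_def \<delta>_def)
        have "(3 :: real) powr (- \<bar>\<alpha>\<bar>) \<le> ((1 - (norm z)\<^sup>2) / \<delta>) powr \<alpha>"
          using bz \<delta> by (intro powr_abs_bounds(2)) (auto simp: field_simps)
        then have "K * 3 powr (- \<bar>\<alpha>\<bar>) \<le> K * ((1 - (norm z)\<^sup>2) / \<delta>) powr \<alpha>"
          using K by (intro mult_left_mono) auto
        also have "K * 3 powr (- \<bar>\<alpha>\<bar>) = 1"
          by (simp add: K_def flip: powr_add)
        also have "((1 - (norm z)\<^sup>2) / \<delta>) powr \<alpha> = (1 - (norm z)\<^sup>2) powr \<alpha> / \<delta> powr \<alpha>"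
          by (rule powr_divide)
        also have "\<dots> = \<delta> powr (- \<alpha>) * (1 - (norm z)\<^sup>2) powr \<alpha>"
          by (simp add: powr_minus_divide)
        finally have "1 * norm (f z) powr q \<le> K * (\<delta> powr (- \<alpha>) * (1 - (norm z)\<^sup>2) powr \<alpha>) * norm (f z) powr q"
          by (intro mult_right_mono) auto
        then have "ennreal (norm (f z) powr q)
          \<le> ennreal (K * (\<delta> powr (- \<alpha>) * (1 - (norm z)\<^sup>2) powr \<alpha>) * norm (f z) powr q)"
          by (intro ennreal_leI) simp
        then show "ennreal (norm (f z) powr q) * indicator (ball 0 1) v \<le> ennreal (K * \<delta> powr (- \<alpha>)) * G z"
          using True \<open>z \<in> kernel_nbhd w\<close> K by (simp add: G_def F_def ennreal_mult mult.assoc)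
      qed simp
    qed
    also have "\<dots> = ennreal (K * \<delta> powr (- \<alpha>)) * (\<integral>\<^sup>+ v. G (w + parabolic t e v) \<partial>lborel)"
      by (rule nn_integral_cmult) measurable
    finally have "ennreal (t ^ (2 * CARD('n) + 2)) * (X * ennreal vol)
      \<le> ennreal (t ^ (2 * CARD('n) + 2)) * (ennreal (K * \<delta> powr (- \<alpha>)) * (\<integral>\<^sup>+ v. G (w + parabolic t e v) \<partial>lborel))"
      by (rule mult_left_mono) simp
    also have "\<dots> = ennreal (K * \<delta> powr (- \<alpha>)) * (ennreal (t ^ (2 * CARD('n) + 2)) * (\<integral>\<^sup>+ v. G (w + parabolic t e v) \<partial>lborel))"
      by (simp only: mult_ac)
    also have "ennreal (t ^ (2 * CARD('n) + 2)) * (\<integral>\<^sup>+ v. G (w + parabolic t e v) \<partial>lborel) = (\<integral>\<^sup>+ z. G (w + z) \<partial>lborel)"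
      by (rule nn_integral_lborel_parabolic[symmetric]) (use t e in auto)
    also have "\<dots> = (\<integral>\<^sup>+ z. G z \<partial>lborel)"
      by (rule nn_integral_lborel_shift) measurable
    finally have 1: "ennreal (t ^ (2 * CARD('n) + 2)) * (X * ennreal vol)
      \<le> ennreal (K * \<delta> powr (- \<alpha>)) * (\<integral>\<^sup>+ z. G z \<partial>lborel)" .
    have tN: "t ^ (2 * CARD('n) + 2) = (\<delta> / 6) ^ N"
      by (simp add: t(2)[symmetric] N_def flip: power_mult power_Suc)
    define B where "B = 6 ^ N / (\<delta> ^ N * vol)"
    have B: "B > 0"
      using \<delta> vol by (simp add: B_def)
    have "B * ((\<delta> / 6) ^ N * vol) = 1"
      using \<delta> vol by (simp add: B_def power_divide)
    then have "ennreal B * (ennreal (t ^ (2 * CARD('n) + 2)) * ennreal vol) = 1"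
      unfolding tN using B \<delta> vol by (simp flip: ennreal_mult)
    moreover have "ennreal B * (ennreal (t ^ (2 * CARD('n) + 2)) * (X * ennreal vol))
      = ennreal B * (ennreal (t ^ (2 * CARD('n) + 2)) * ennreal vol) * X"
      by (simp only: mult_ac)
    ultimately have "X = ennreal B * (ennreal (t ^ (2 * CARD('n) + 2)) * (X * ennreal vol))"
      by (simp only: mult_1)
    also have "\<dots> \<le> ennreal B * (ennreal (K * \<delta> powr (- \<alpha>)) * (\<integral>\<^sup>+ z. G z \<partial>lborel))"
      by (intro mult_left_mono 1) simp
    also have "\<dots> = ennreal (B * K * \<delta> powr (- \<alpha>) / c) * (ennreal c * (\<integral>\<^sup>+ z. G z \<partial>lborel))"
    proof -
      have "ennreal B * ennreal (K * \<delta> powr (- \<alpha>)) = ennreal (B * K * \<delta> powr (- \<alpha>) / c) * ennreal c"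
        using B K c by (simp add: mult.assoc flip: ennreal_mult)
      then show ?thesis
        by (simp only: mult.assoc[symmetric])
    qed
    also have "B * K * \<delta> powr (- \<alpha>) / c = K * 6 ^ N / (c * vol) * \<delta> powr (- (\<alpha> + real CARD('n) + 1))"
    proof -
      have "- (\<alpha> + real CARD('n) + 1) = - \<alpha> - real N"
        by (simp add: N_def)
      then have "\<delta> powr (- (\<alpha> + real CARD('n) + 1)) = \<delta> powr (- \<alpha>) / \<delta> ^ N"
        using \<delta> by (simp only: powr_diff powr_realpow)
      then show ?thesis
        by (simp add: B_def mult_ac)
    qed
    finally show "ennreal (norm (f w) powr q) \<le> ennreal (K * 6 ^ N / (c * vol) * (1 - norm w) powr (- (\<alpha> + real CARD('n) + 1))) *
        (\<integral>\<^sup>+ z. ennreal (norm (f z) powr q) * indicator (kernel_nbhd w) z \<partial>bergman_measure \<alpha>)"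
      unfolding J[symmetric] J_def X_def \<delta>_def .
  qed
qed

lemma holo_on_const: "holo_on (\<lambda>_. c) S"
  unfolding holo_on_def by (intro ballI exI[of _ "\<lambda>_. 0"]) simp

text \<open>This is the pointwise estimate for the constant function \<open>1\<close>.\<close>

lemma emeasure_kernel_nbhd_ge:
  assumes \<alpha>: "\<alpha> > -1"
  obtains c where "c > 0"
    "\<And>w :: complex ^ 'n. w \<in> ball 0 1 \<Longrightarrow>
      ennreal (c * (1 - norm w) powr (\<alpha> + real CARD('n) + 1)) \<le> emeasure (bergman_measure \<alpha>) (kernel_nbhd w)"
proof (rule holo_pointwise_le[OF \<alpha>, of 2, where 'n = 'n], goal_cases)
  case (2 C)
  show thesis
  proof (rule that[of "1 / C"])
    show "1 / C > 0"
      using 2 by simp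
    fix w :: "complex ^ 'n"
    assume w: "w \<in> ball 0 1"
    define d where "d = (1 - norm w) powr (\<alpha> + real CARD('n) + 1)"
    have d: "d > 0"
      using w by (simp add: d_def)
    have "kernel_nbhd w \<in> sets (bergman_measure \<alpha>)"
      by (rule borel_subset_in_sets_bergman[OF borel_kernel_nbhd kernel_nbhd_subset_ball])
    then have "1 \<le> ennreal (C * inverse d) * emeasure (bergman_measure \<alpha>) (kernel_nbhd w)"
      using 2(3)[OF holo_on_const[of 1] w] unfolding powr_minus d_def by simp
    then have "ennreal (1 / C * d) * 1 \<le> ennreal (1 / C * d) * (ennreal (C * inverse d) * emeasure (bergman_measure \<alpha>) (kernel_nbhd w))"
      by (rule mult_left_mono) simp
    also have "\<dots> = emeasure (bergman_measure \<alpha>) (kernel_nbhd w)"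
      using 2(2) d by (simp add: mult.assoc[symmetric] ennreal_mult[symmetric])
    finally show "ennreal (1 / C * (1 - norm w) powr (\<alpha> + real CARD('n) + 1)) \<le> emeasure (bergman_measure \<alpha>) (kernel_nbhd w)"
      by (simp add: d_def)
  qed
qed simp

section \<open>The weighted embedding\<close>

lemma holo_measurable_restrict:
  assumes "holo_on f (ball 0 1)"
  shows "f \<in> borel_measurable (restrict_space borel (ball 0 1))"
  by (rule borel_measurable_continuous_on_restrict[OF holo_on_continuous[OF assms]])

lemma measurable_restrict_imp_bergman:
  assumes "f \<in> borel_measurable (restrict_space borel (ball (0 :: complex ^ 'n) 1))"
  shows "f \<in> borel_measurable (bergman_measure \<alpha>)"
proof -
  have "(\<lambda>z. z) \<in> measurable (bergman_measure \<alpha>) (restrict_space borel (ball (0 :: complex ^ 'n) 1))"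
  proof (rule measurable_restrict_space2)
    have "(\<lambda>z :: complex ^ 'n. z) \<in> borel_measurable (lebesgue_on (ball 0 1))"
      by (intro continuous_imp_measurable_on_sets_lebesgue continuous_intros) auto
    then show "(\<lambda>z :: complex ^ 'n. z) \<in> borel_measurable (bergman_measure \<alpha>)"
      by (simp add: bergman_measure_def)
  qed auto
  from measurable_compose[OF this assms] show ?thesis .
qed

lemma measurable_bergman_ident: "(\<lambda>z. z) \<in> borel_measurable (bergman_measure \<alpha>)"
  by (rule measurable_restrict_imp_bergman) (simp add: measurable_restrict_space1)

lemma holo_self_map_measurable:
  assumes "holo_self_map \<phi>"
  shows "\<phi> \<in> measurable (bergman_measure \<alpha>) (restrict_space borel (ball 0 1))"
proof (rule measurable_restrict_space2)
  have "continuous_on (ball 0 1) (\<lambda>z. \<chi> i. \<phi> z $ i)"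
    using assms holo_on_continuous unfolding holo_self_map_def
    by (intro continuous_on_vec_lambda) blast
  then have "continuous_on (ball 0 1) \<phi>"
    by simp
  then show "\<phi> \<in> borel_measurable (bergman_measure \<alpha>)"
    by (intro measurable_restrict_imp_bergman borel_measurable_continuous_on_restrict)
  show "\<phi> \<in> space (bergman_measure \<alpha>) \<rightarrow> ball 0 1"
    using assms by (auto simp: holo_self_map_def)
qed

lemma continuous_on_herm_UNIV: "continuous_on UNIV (\<lambda>x. herm (fst x) (snd x))"
  by (intro continuous_intros)

lemma borel_measurable_herm [measurable (raw)]:
  fixes f g :: "_ \<Rightarrow> complex ^ 'n"
  assumes "f \<in> borel_measurable M" "g \<in> borel_measurable M"
  shows "(\<lambda>x. herm (f x) (g x)) \<in> borel_measurable M"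
  by (rule borel_measurable_continuous_Pair[OF assms continuous_on_herm_UNIV])

lemma finite_measure_bergman:
  assumes "\<alpha> > -1"
  shows "finite_measure (bergman_measure \<alpha> :: (complex ^ 'n) measure)"
  using emeasure_bergman_ball_finite[OF assms, where 'n = 'n] by (intro finite_measureI) auto

lemma norm_herm_lt_1:
  assumes "z \<in> ball 0 1" "w \<in> ball 0 1"
  shows "norm (herm z w) < 1"
proof -
  have "norm z * norm w \<le> 1 * norm w"
    using assms by (intro mult_right_mono) auto
  then show ?thesis
    using norm_herm_le[of z w] assms by simp
qed

lemma norm_one_minus_herm_pos:
  assumes "z \<in> ball 0 1" "w \<in> ball 0 1"
  shows "norm (1 - herm z w) > 0"
  using norm_herm_lt_1[OF assms] by auto

text \<open>On \<open>kernel_nbhd w\<close> the factor \<open>(1 - |w|)\<^bsup>-m\<^esup>\<close> of the pointwise estimate is at most a constant times the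
kernel \<open>|1 - \<langle>z, w\<rangle>|\<^bsup>-m\<^esup>\<close>. Integrate in \<open>w\<close> and exchange the integrals. The hypothesis at \<open>z = 0\<close> says
that the measure is finite, as the exchange requires.\<close>

lemma carleson_embedding:
  assumes \<alpha>: "\<alpha> > -1" and q: "q > 1"
  obtains C where "C > 0"
    "\<And>(\<nu> :: (complex ^ 'n) measure) M f. \<lbrakk>sets \<nu> = sets (restrict_space borel (ball 0 1)); M < \<infinity>;
      \<forall>z\<in>ball 0 1.
        (\<integral>\<^sup>+ w. ennreal (1 / norm (1 - herm z w) powr (\<alpha> + real CARD('n) + 1)) \<partial>\<nu>) \<le> M;
      holo_on f (ball 0 1)\<rbrakk> \<Longrightarrow>
      (\<integral>\<^sup>+ w. ennreal (norm (f w) powr q) \<partial>\<nu>)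
        \<le> ennreal C * M * (\<integral>\<^sup>+ z. ennreal (norm (f z) powr q) \<partial>bergman_measure \<alpha>)"
proof -
  define m where "m = \<alpha> + real CARD('n) + 1"
  have m: "m > 0"
    using \<alpha> by (simp add: m_def)
  obtain C0 where C0: "C0 > 0"
    "\<And>(f :: complex ^ 'n \<Rightarrow> complex) w. holo_on f (ball 0 1) \<Longrightarrow> w \<in> ball 0 1 \<Longrightarrow>
      ennreal (norm (f w) powr q) \<le> ennreal (C0 * (1 - norm w) powr (- (\<alpha> + real CARD('n) + 1))) *
        (\<integral>\<^sup>+ z. ennreal (norm (f z) powr q) * indicator (kernel_nbhd w) z \<partial>bergman_measure \<alpha>)"
    by (rule holo_pointwise_le[OF \<alpha> q, where 'n = 'n]) (rule that)
  note C0 = C0[folded m_def]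
  define C where "C = C0 * 3 powr m"
  have C: "C > 0"
    using C0(1) by (simp add: C_def)
  show thesis
  proof (rule that[OF C], fold m_def)
    fix \<nu> :: "(complex ^ 'n) measure" and M and f :: "complex ^ 'n \<Rightarrow> complex"
    assume \<nu>: "sets \<nu> = sets (restrict_space borel (ball 0 1))" and M: "M < \<infinity>"
      and le: "\<forall>z\<in>ball 0 1. (\<integral>\<^sup>+ w. ennreal (1 / norm (1 - herm z w) powr m) \<partial>\<nu>) \<le> M"
      and f: "holo_on f (ball 0 1)"
    define V where "V = (bergman_measure \<alpha> :: (complex ^ 'n) measure)"
    have sp: "space \<nu> = ball 0 1" "space V = ball 0 1"
      using sets_eq_imp_space_eq[OF \<nu>] by (simp_all add: space_restrict_space V_def)
    interpret \<nu>: finite_measure \<nu>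
    proof (rule finite_measureI)
      have "emeasure \<nu> (space \<nu>) \<le> M"
        using le by (auto dest: bspec[of _ _ 0])
      then show "emeasure \<nu> (space \<nu>) \<noteq> \<infinity>"
        using M by (auto simp: top_unique)
    qed
    interpret V: finite_measure V
      unfolding V_def by (rule finite_measure_bergman[OF \<alpha>])
    interpret pair_sigma_finite V \<nu> ..
    have [measurable]: "f \<in> borel_measurable V"
      unfolding V_def by (rule measurable_restrict_imp_bergman[OF holo_measurable_restrict[OF f]])
    have idV: "(\<lambda>z. z) \<in> borel_measurable V"
      unfolding V_def by (rule measurable_bergman_ident)
    have id\<nu>: "(\<lambda>w. w) \<in> borel_measurable \<nu>"
      using \<nu> by (simp add: measurable_restrict_space1 cong: measurable_cong_sets)
    note [measurable] = idV id\<nu> measurable_compose[OF measurable_fst idV, of \<nu>] measurable_compose[OF measurable_snd id\<nu>, of V]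
    have [measurable]: "(\<lambda>x. f (fst x)) \<in> borel_measurable (V \<Otimes>\<^sub>M \<nu>)"
      by (rule measurable_compose[OF measurable_fst]) measurable
    let ?k = "\<lambda>z w. ennreal C * (ennreal (norm (f z) powr q) * ennreal (1 / norm (1 - herm z w) powr m))"
    have "(\<integral>\<^sup>+ w. ennreal (norm (f w) powr q) \<partial>\<nu>) \<le> (\<integral>\<^sup>+ w. (\<integral>\<^sup>+ z. ?k z w \<partial>V) \<partial>\<nu>)"
    proof (rule nn_integral_mono)
      fix w
      assume "w \<in> space \<nu>"
      then have w: "w \<in> ball 0 1"
        by (simp add: sp)
      have [measurable]: "kernel_nbhd w \<in> sets V"
        unfolding V_def by (rule borel_subset_in_sets_bergman[OF borel_kernel_nbhd kernel_nbhd_subset_ball])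
      have "ennreal (norm (f w) powr q) \<le> ennreal (C0 * (1 - norm w) powr (- m)) *
          (\<integral>\<^sup>+ z. ennreal (norm (f z) powr q) * indicator (kernel_nbhd w) z \<partial>V)"
        unfolding V_def by (rule C0(2)[OF f w])
      also have "\<dots> = (\<integral>\<^sup>+ z. ennreal (C0 * (1 - norm w) powr (- m)) *
          (ennreal (norm (f z) powr q) * indicator (kernel_nbhd w) z) \<partial>V)"
        by (rule nn_integral_cmult[symmetric]) measurable
      also have "\<dots> \<le> (\<integral>\<^sup>+ z. ?k z w \<partial>V)"
      proof (rule nn_integral_mono)
        fix z
        assume "z \<in> space V"
        then have z: "z \<in> ball 0 1"
          by (simp add: sp)
        show "ennreal (C0 * (1 - norm w) powr (- m)) * (ennreal (norm (f z) powr q) * indicator (kernel_nbhd w) z) \<le> ?k z w"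
        proof (cases "z \<in> kernel_nbhd w")
          case True
          have p: "norm (1 - herm z w) > 0"
            by (rule norm_one_minus_herm_pos[OF z w])
          have d: "1 - norm w > 0"
            using w by simp
          have "norm (1 - herm z w) powr m \<le> (3 * (1 - norm w)) powr m"
            using True m by (intro powr_mono2) (auto simp: kernel_nbhd_def)
          also have "\<dots> = 3 powr m * (1 - norm w) powr m"
            by (rule powr_mult)
          finally have "(1 - norm w) powr (- m) \<le> 3 powr m * (1 / norm (1 - herm z w) powr m)"
            using p d by (simp add: powr_minus field_simps)
          then have "C0 * (1 - norm w) powr (- m) \<le> C0 * (3 powr m * (1 / norm (1 - herm z w) powr m))"
            using C0(1) by (intro mult_left_mono) auto
          then have "C0 * (1 - norm w) powr (- m) \<le> C * (1 / norm (1 - herm z w) powr m)"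
            by (simp only: C_def mult.assoc)
          then have "ennreal (C0 * (1 - norm w) powr (- m)) \<le> ennreal (C * (1 / norm (1 - herm z w) powr m))"
            by (rule ennreal_leI)
          also have "\<dots> = ennreal C * ennreal (1 / norm (1 - herm z w) powr m)"
            using C by (intro ennreal_mult) auto
          finally have "ennreal (C0 * (1 - norm w) powr (- m)) * ennreal (norm (f z) powr q)
            \<le> ennreal C * ennreal (1 / norm (1 - herm z w) powr m) * ennreal (norm (f z) powr q)"
            by (rule mult_right_mono) simp
          then show ?thesis
            using True by (simp only: indicator_simps mult_1 mult_ac)
        qed simp
      qed
      finally show "ennreal (norm (f w) powr q) \<le> (\<integral>\<^sup>+ z. ?k z w \<partial>V)" .
    qed
    also have "\<dots> = (\<integral>\<^sup>+ z. (\<integral>\<^sup>+ w. ?k z w \<partial>\<nu>) \<partial>V)"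
      by (rule Fubini') (unfold split_beta, measurable)
    also have "\<dots> \<le> (\<integral>\<^sup>+ z. ennreal C * M * ennreal (norm (f z) powr q) \<partial>V)"
    proof (rule nn_integral_mono)
      fix z
      assume "z \<in> space V"
      then have z: "z \<in> ball 0 1"
        by (simp add: sp)
      have "(\<integral>\<^sup>+ w. ?k z w \<partial>\<nu>) = ennreal C * (ennreal (norm (f z) powr q) * (\<integral>\<^sup>+ w. ennreal (1 / norm (1 - herm z w) powr m) \<partial>\<nu>))"
        by (simp add: nn_integral_cmult)
      also have "\<dots> \<le> ennreal C * (ennreal (norm (f z) powr q) * M)"
        by (intro mult_left_mono le[rule_format] z) auto
      finally show "(\<integral>\<^sup>+ w. ?k z w \<partial>\<nu>) \<le> ennreal C * M * ennreal (norm (f z) powr q)"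
        by (simp only: mult_ac)
    qed
    also have "\<dots> = ennreal C * M * (\<integral>\<^sup>+ z. ennreal (norm (f z) powr q) \<partial>V)"
      by (rule nn_integral_cmult) measurable
    finally show "(\<integral>\<^sup>+ w. ennreal (norm (f w) powr q) \<partial>\<nu>)
        \<le> ennreal C * M * (\<integral>\<^sup>+ z. ennreal (norm (f z) powr q) \<partial>bergman_measure \<alpha>)"
      by (simp add: V_def)
  qed
qed

lemma bergman_norm_powr:
  assumes "f \<in> bergman_space \<alpha> q" "q > 1"
  shows "ennreal (bergman_norm \<alpha> q f powr q) = (\<integral>\<^sup>+ z. ennreal (norm (f z) powr q) \<partial>bergman_measure \<alpha>)"
proof -
  have "(\<integral>\<^sup>+ z. ennreal (norm (f z) powr q) \<partial>bergman_measure \<alpha>)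
    = ennreal (LINT z|bergman_measure \<alpha>. norm (f z) powr q)"
    using assms by (intro nn_integral_eq_integral) (auto simp: bergman_space_def)
  moreover have "bergman_norm \<alpha> q f powr q = (LINT z|bergman_measure \<alpha>. norm (f z) powr q)"
    using assms(2) unfolding bergman_norm_def by (simp add: powr_powr integral_nonneg_AE)
  ultimately show ?thesis by simp
qed

lemma bergman_bounded_weighted_comp:
  assumes W: "bergman_bounded \<alpha> q (weighted_comp u \<phi>)" and q: "q > 1"
  obtains A where "A > 0"
    "\<And>f. f \<in> bergman_space \<alpha> q \<Longrightarrow>
      (\<integral>\<^sup>+ z. ennreal (norm (u z) powr q * norm (f (\<phi> z)) powr q) \<partial>bergman_measure \<alpha>)
        \<le> ennreal A * (\<integral>\<^sup>+ z. ennreal (norm (f z) powr q) \<partial>bergman_measure \<alpha>)"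
proof -
  obtain K where W1: "\<And>f. f \<in> bergman_space \<alpha> q \<Longrightarrow> weighted_comp u \<phi> f \<in> bergman_space \<alpha> q"
    and K: "\<And>f. f \<in> bergman_space \<alpha> q \<Longrightarrow> bergman_norm \<alpha> q (weighted_comp u \<phi> f) \<le> K * bergman_norm \<alpha> q f"
    using W unfolding bergman_bounded_def by blast
  define A where "A = (\<bar>K\<bar> + 1) powr q"
  show thesis
  proof (rule that[of A])
    show "A > 0"
      by (simp add: A_def add_nonneg_pos)
    fix f :: "complex ^ 'a \<Rightarrow> complex"
    assume f: "f \<in> bergman_space \<alpha> q"
    have n: "bergman_norm \<alpha> q g \<ge> 0" for g :: "complex ^ 'a \<Rightarrow> complex"
      by (simp add: bergman_norm_def)
    have "(\<integral>\<^sup>+ z. ennreal (norm (u z) powr q * norm (f (\<phi> z)) powr q) \<partial>bergman_measure \<alpha>)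
      = (\<integral>\<^sup>+ z. ennreal (norm (weighted_comp u \<phi> f z) powr q) \<partial>bergman_measure \<alpha>)"
      by (simp add: weighted_comp_def norm_mult powr_mult)
    also have "\<dots> = ennreal (bergman_norm \<alpha> q (weighted_comp u \<phi> f) powr q)"
      by (rule bergman_norm_powr[OF W1[OF f] q, symmetric])
    also have "\<dots> \<le> ennreal (((\<bar>K\<bar> + 1) * bergman_norm \<alpha> q f) powr q)"
    proof (intro ennreal_leI powr_mono2)
      have "K * bergman_norm \<alpha> q f \<le> (\<bar>K\<bar> + 1) * bergman_norm \<alpha> q f"
        using n by (intro mult_right_mono) auto
      then show "bergman_norm \<alpha> q (weighted_comp u \<phi> f) \<le> (\<bar>K\<bar> + 1) * bergman_norm \<alpha> q f"
        using K[OF f] by linarith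
    qed (use n q in auto)
    also have "\<dots> = ennreal A * ennreal (bergman_norm \<alpha> q f powr q)"
      using n by (simp add: A_def powr_mult ennreal_mult)
    also have "ennreal (bergman_norm \<alpha> q f powr q) = (\<integral>\<^sup>+ z. ennreal (norm (f z) powr q) \<partial>bergman_measure \<alpha>)"
      by (rule bergman_norm_powr[OF f q])
    finally show "(\<integral>\<^sup>+ z. ennreal (norm (u z) powr q * norm (f (\<phi> z)) powr q) \<partial>bergman_measure \<alpha>)
        \<le> ennreal A * (\<integral>\<^sup>+ z. ennreal (norm (f z) powr q) \<partial>bergman_measure \<alpha>)" .
  qed
qed

lemma le_interpolate:
  fixes k x s :: real
  assumes "k > 0" "x \<ge> 0" "s \<ge> 1"
  shows "x \<le> k + k powr (1 - s) * x powr s"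
proof (cases "x \<le> k")
  case False
  then have "x > 0"
    using assms by simp
  have "x = x powr (1 - s) * x powr s"
    using \<open>x > 0\<close> by (simp flip: powr_add)
  also have "\<dots> \<le> k powr (1 - s) * x powr s"
    using False assms by (intro mult_right_mono powr_mono2') auto
  finally show ?thesis
    using assms by linarith
qed (use assms in \<open>simp add: add_increasing2\<close>)


text \<open>The embedding, applied to the measure with weight \<open>\<omega>\<^sup>s\<close>, is combined with the boundedness of the
operator by means of \<open>\<omega> \<le> k + k\<^bsup>1-s\<^esup> \<omega>\<^sup>s\<close>.\<close>

lemma weighted_integral_le:
  fixes u :: "complex ^ 'n \<Rightarrow> complex"
  assumes \<alpha>: "\<alpha> > -1" and q: "q > 1" and s: "s > 1"
    and u: "holo_on u (ball 0 1)" and \<phi>: "holo_self_map \<phi>"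
    and W: "bergman_bounded \<alpha> q (weighted_comp u \<phi>)"
  obtains C where "C > 0"
    "\<And>\<omega> f. \<lbrakk>weight \<omega>; (\<lambda>z. \<omega> z powr s) \<in> weight_class \<alpha> q u \<phi>; f \<in> bergman_space \<alpha> q\<rbrakk> \<Longrightarrow>
      (\<integral>\<^sup>+ z. ennreal (norm (u z) powr q * norm (f (\<phi> z)) powr q * \<omega> z) \<partial>bergman_measure \<alpha>)
        \<le> ennreal (C * enn2real (weight_const \<alpha> q u \<phi> (\<lambda>z. \<omega> z powr s)) powr (1 / s)
            * bergman_norm \<alpha> q f powr q)"
proof -
  obtain C1 where C1: "C1 > 0"
    "\<And>(\<nu> :: (complex ^ 'n) measure) M f. \<lbrakk>sets \<nu> = sets (restrict_space borel (ball 0 1)); M < \<infinity>;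
      \<forall>z\<in>ball 0 1.
        (\<integral>\<^sup>+ w. ennreal (1 / norm (1 - herm z w) powr (\<alpha> + real CARD('n) + 1)) \<partial>\<nu>) \<le> M;
      holo_on f (ball 0 1)\<rbrakk> \<Longrightarrow>
      (\<integral>\<^sup>+ w. ennreal (norm (f w) powr q) \<partial>\<nu>)
        \<le> ennreal C1 * M * (\<integral>\<^sup>+ z. ennreal (norm (f z) powr q) \<partial>bergman_measure \<alpha>)"
    by (rule carleson_embedding[OF \<alpha> q, where 'n = 'n]) (rule that)
  obtain A where A: "A > 0"
    "\<And>f. f \<in> bergman_space \<alpha> q \<Longrightarrow>
      (\<integral>\<^sup>+ z. ennreal (norm (u z) powr q * norm (f (\<phi> z)) powr q) \<partial>bergman_measure \<alpha>)
        \<le> ennreal A * (\<integral>\<^sup>+ z. ennreal (norm (f z) powr q) \<partial>bergman_measure \<alpha>)"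
    by (rule bergman_bounded_weighted_comp[OF W q]) (rule that)
  define V where "V = (bergman_measure \<alpha> :: (complex ^ 'n) measure)"
  have [measurable]: "u \<in> borel_measurable V"
    unfolding V_def by (rule measurable_restrict_imp_bergman[OF holo_measurable_restrict[OF u]])
  show thesis
  proof (rule that[of "A + C1"])
    show "A + C1 > 0"
      using A C1 by simp
    fix \<omega> :: "complex ^ 'n \<Rightarrow> real" and f :: "complex ^ 'n \<Rightarrow> complex"
    assume \<omega>: "weight \<omega>" and cl: "(\<lambda>z. \<omega> z powr s) \<in> weight_class \<alpha> q u \<phi>" and f: "f \<in> bergman_space \<alpha> q"
    have hf: "holo_on f (ball 0 1)"
      using f by (simp add: bergman_space_def)
    have [measurable]: "(\<lambda>z. f (\<phi> z)) \<in> borel_measurable V"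
      unfolding V_def
      by (rule measurable_compose[OF holo_self_map_measurable[OF \<phi>] holo_measurable_restrict[OF hf]])
    have [measurable]: "\<omega> \<in> borel_measurable V"
      using \<omega> by (simp add: weight_def V_def bergman_measure_def)
    have \<omega>0: "\<omega> z \<ge> 0" if "z \<in> space V" for z
      using \<omega> that by (simp add: weight_def V_def)
    have ws: "weight (\<lambda>z. \<omega> z powr s)" and fin: "weight_const \<alpha> q u \<phi> (\<lambda>z. \<omega> z powr s) < \<infinity>"
      using cl by (auto simp: weight_class_def)
    define M where "M = enn2real (weight_const \<alpha> q u \<phi> (\<lambda>z. \<omega> z powr s))"
    have M: "M \<ge> 0" "weight_const \<alpha> q u \<phi> (\<lambda>z. \<omega> z powr s) = ennreal M"
      using fin by (simp_all add: M_def)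
    define N where "N = bergman_norm \<alpha> q f powr q"
    have N: "N \<ge> 0" "(\<integral>\<^sup>+ z. ennreal (norm (f z) powr q) \<partial>V) = ennreal N"
      unfolding V_def by (simp_all add: N_def bergman_norm_powr[OF f q])
    define \<rho> where "\<rho> = (\<lambda>z. norm (u z) powr q * norm (f (\<phi> z)) powr q)"
    have \<rho>: "\<rho> z \<ge> 0" for z
      by (simp add: \<rho>_def)
    have [measurable]: "\<rho> \<in> borel_measurable V"
      unfolding \<rho>_def by measurable
    have I1: "(\<integral>\<^sup>+ z. ennreal (\<rho> z) \<partial>V) \<le> ennreal (A * N)"
      using A(2)[OF f] A(1) N by (simp add: \<rho>_def V_def ennreal_mult)
    define \<nu> where "\<nu> = pushforward_measure u \<phi> q (\<lambda>z. \<omega> z powr s) \<alpha>"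
    have fm: "(\<lambda>w. ennreal (norm (f w) powr q)) \<in> borel_measurable (restrict_space borel (ball 0 1))"
      using holo_measurable_restrict[OF hf] by measurable
    have "(\<integral>\<^sup>+ z. ennreal (\<rho> z * \<omega> z powr s) \<partial>V) = (\<integral>\<^sup>+ w. ennreal (norm (f w) powr q) \<partial>\<nu>)"
      unfolding \<nu>_def V_def \<rho>_def by (subst nn_integral_pushforward_measure[OF u \<phi> ws fm]) (simp add: ennreal_mult)
    also have "\<dots> \<le> ennreal C1 * ennreal M * (\<integral>\<^sup>+ z. ennreal (norm (f z) powr q) \<partial>bergman_measure \<alpha>)"
    proof (rule C1(2)[OF _ _ _ hf])
      show "sets \<nu> = sets (restrict_space borel (ball 0 1))"
        by (simp add: \<nu>_def pushforward_measure_def)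
      show "\<forall>z\<in>ball 0 1. (\<integral>\<^sup>+ w. ennreal (1 / norm (1 - herm z w) powr (\<alpha> + real CARD('n) + 1)) \<partial>\<nu>) \<le> ennreal M"
      proof
        fix z :: "complex ^ 'n"
        assume z: "z \<in> ball 0 1"
        have id: "(\<lambda>w :: complex ^ 'n. w) \<in> borel_measurable (restrict_space borel (ball 0 1))"
          by (simp add: measurable_restrict_space1)
        have km: "(\<lambda>w. ennreal (1 / norm (1 - herm z w) powr (\<alpha> + real CARD('n) + 1))) \<in> borel_measurable (restrict_space borel (ball 0 1))"
          using id by measurable
        have "(\<integral>\<^sup>+ w. ennreal (1 / norm (1 - herm z w) powr (\<alpha> + real CARD('n) + 1)) \<partial>\<nu>)
          = (\<integral>\<^sup>+ x. ennreal (norm (u x) powr q * \<omega> x powr s / norm (1 - herm z (\<phi> x)) powr (\<alpha> + real CARD('n) + 1)) \<partial>bergman_measure \<alpha>)"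
          unfolding \<nu>_def by (subst nn_integral_pushforward_measure[OF u \<phi> ws km])
            (simp add: mult_ac flip: ennreal_mult)
        also have "\<dots> \<le> weight_const \<alpha> q u \<phi> (\<lambda>z. \<omega> z powr s)"
          unfolding weight_const_def by (rule SUP_upper[OF z])
        finally show "(\<integral>\<^sup>+ w. ennreal (1 / norm (1 - herm z w) powr (\<alpha> + real CARD('n) + 1)) \<partial>\<nu>) \<le> ennreal M"
          by (simp add: M)
      qed
    qed simp
    finally have I2: "(\<integral>\<^sup>+ z. ennreal (\<rho> z * \<omega> z powr s) \<partial>V) \<le> ennreal (C1 * M * N)"
      using C1(1) M(1) N(1) by (simp add: N(2)[unfolded V_def] ennreal_mult)
    have "(\<integral>\<^sup>+ z. ennreal (\<rho> z * \<omega> z) \<partial>V) \<le> ennreal ((A + C1) * M powr (1 / s) * N)"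
    proof (cases "M = 0")
      case True
      then have "(\<integral>\<^sup>+ z. ennreal (\<rho> z * \<omega> z powr s) \<partial>V) = 0"
        using I2 by simp
      (* no choice of k balances the two terms now, but the integrands vanish almost everywhere *)
      then have "AE z in V. ennreal (\<rho> z * \<omega> z powr s) = 0"
        by (subst (asm) nn_integral_0_iff_AE) auto
      then have "AE z in V. ennreal (\<rho> z * \<omega> z) = 0"
        by eventually_elim (use \<rho> in \<open>auto simp: ennreal_eq_0_iff mult_le_0_iff not_le order.antisym\<close>)
      then have "(\<integral>\<^sup>+ z. ennreal (\<rho> z * \<omega> z) \<partial>V) = 0"
        by (subst nn_integral_0_iff_AE) auto
      then show ?thesis
        by simp
    next
      case False
      (* with this k both k and k powr (1 - s) * M are equal to M powr (1 / s) *)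
      define k where "k = M powr (1 / s)"
      have k: "k > 0"
        using False M by (simp add: k_def)
      have "(\<integral>\<^sup>+ z. ennreal (\<rho> z * \<omega> z) \<partial>V)
        \<le> (\<integral>\<^sup>+ z. ennreal k * ennreal (\<rho> z) + ennreal (k powr (1 - s)) * ennreal (\<rho> z * \<omega> z powr s) \<partial>V)"
      proof (rule nn_integral_mono)
        fix z
        assume z: "z \<in> space V"
        have "\<rho> z * \<omega> z \<le> \<rho> z * (k + k powr (1 - s) * \<omega> z powr s)"
          using s by (intro mult_left_mono le_interpolate k \<omega>0[OF z] \<rho>) auto
        then have "\<rho> z * \<omega> z \<le> k * \<rho> z + k powr (1 - s) * (\<rho> z * \<omega> z powr s)"
          by (simp add: algebra_simps)
        then have "ennreal (\<rho> z * \<omega> z) \<le> ennreal (k * \<rho> z + k powr (1 - s) * (\<rho> z * \<omega> z powr s))"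
          by (rule ennreal_leI)
        then show "ennreal (\<rho> z * \<omega> z) \<le> ennreal k * ennreal (\<rho> z) + ennreal (k powr (1 - s)) * ennreal (\<rho> z * \<omega> z powr s)"
          using k \<rho>[of z] by (simp only: ennreal_plus ennreal_mult mult_nonneg_nonneg powr_ge_zero less_imp_le)
      qed
      also have "\<dots> = ennreal k * (\<integral>\<^sup>+ z. ennreal (\<rho> z) \<partial>V) + ennreal (k powr (1 - s)) * (\<integral>\<^sup>+ z. ennreal (\<rho> z * \<omega> z powr s) \<partial>V)"
        by (simp add: nn_integral_add nn_integral_cmult)
      also have "\<dots> \<le> ennreal k * ennreal (A * N) + ennreal (k powr (1 - s)) * ennreal (C1 * M * N)"
        by (intro add_mono mult_left_mono I1 I2) auto
      also have "\<dots> = ennreal (k * (A * N) + k powr (1 - s) * (C1 * M * N))"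
        using k A(1) C1(1) M(1) N(1) by (simp flip: ennreal_mult ennreal_plus)
      also have "k * (A * N) + k powr (1 - s) * (C1 * M * N) = (A + C1) * M powr (1 / s) * N"
      proof -
        have "k powr s = M"
          using s M by (simp add: k_def powr_powr)
        then have "k powr (1 - s) * M = k"
          using k by (metis add.commute diff_add_cancel powr_add powr_one less_imp_le)
        moreover have "k powr (1 - s) * (C1 * M * N) = (k powr (1 - s) * M) * (C1 * N)"
          by (simp only: mult_ac)
        ultimately show ?thesis
          by (simp add: k_def[symmetric] algebra_simps)
      qed
      finally show ?thesis .
    qed
    then show "(\<integral>\<^sup>+ z. ennreal (norm (u z) powr q * norm (f (\<phi> z)) powr q * \<omega> z) \<partial>bergman_measure \<alpha>)
        \<le> ennreal ((A + C1) * enn2real (weight_const \<alpha> q u \<phi> (\<lambda>z. \<omega> z powr s)) powr (1 / s) * bergman_norm \<alpha> q f powr q)"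
      by (simp add: \<rho>_def V_def M_def N_def)
  qed
qed

section \<open>Test functions\<close>

lemma one_minus_herm_le:
  assumes "w \<in> ball 0 1"
  shows "norm (1 - herm w a) \<le> norm (1 - herm w b) + norm (a - b)"
proof -
  have "1 - herm w a = (1 - herm w b) - herm w (a - b)"
    by (simp add: herm_diff_right)
  then have "norm (1 - herm w a) \<le> norm (1 - herm w b) + norm (herm w (a - b))"
    using norm_triangle_ineq4 by metis
  moreover have "norm w * norm (a - b) \<le> 1 * norm (a - b)"
    using assms by (intro mult_right_mono) auto
  ultimately show ?thesis
    using norm_herm_le[of w "a - b"] by simp
qed

lemma dist_direction:
  assumes "norm e = 1" "a = norm a *\<^sub>R e" "norm a \<le> 1"
  shows "norm (e - a) = 1 - norm a" "norm (a - e) = 1 - norm a"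
proof -
  have "e - a = (1 - norm a) *\<^sub>R e"
    by (subst assms(2)) (simp add: algebra_simps)
  then show "norm (e - a) = 1 - norm a"
    using assms by simp
  then show "norm (a - e) = 1 - norm a"
    by (simp add: norm_minus_commute)
qed

lemma holo_on_kernel_power:
  fixes a :: "complex ^ 'n"
  assumes a: "a \<in> ball 0 1"
  shows "holo_on (\<lambda>z. inverse (1 - herm z a) ^ N) (ball 0 1)"
  unfolding holo_on_def
proof
  fix z :: "complex ^ 'n"
  assume z: "z \<in> ball 0 1"
  have "herm z a \<noteq> 1"
    using norm_herm_lt_1[OF z a] by auto
  then have "(\<lambda>x. inverse (1 - x) ^ N) field_differentiable at (herm z a)"
    by (intro holomorphic_on_imp_differentiable_at[of _ "- {1}"] holomorphic_intros) auto
  then obtain g' where g': "((\<lambda>x. inverse (1 - x) ^ N) has_field_derivative g') (at (herm z a))"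
    unfolding field_differentiable_def by blast
  have "bounded_linear (\<lambda>v. herm v a)"
    unfolding linear_conv_bounded_linear[symmetric]
    by (rule linearI) (simp_all add: herm_add_left herm_scaleR_left flip: scaleR_conv_of_real)
  then have "((\<lambda>v. herm v a) has_derivative (\<lambda>v. herm v a)) (at z)"
    by (rule bounded_linear_imp_has_derivative)
  from has_derivative_compose[OF this g'[unfolded has_field_derivative_def]]
  have "((\<lambda>z. inverse (1 - herm z a) ^ N) has_derivative (\<lambda>v. g' * herm v a)) (at z)" .
  then show "\<exists>D. ((\<lambda>z. inverse (1 - herm z a) ^ N) has_derivative D) (at z) \<and> (\<forall>c v. D (c *s v) = c * D v)"
    by (intro exI[of _ "\<lambda>v. g' * herm v a"]) (simp add: herm_smult_left)
qed

lemma nn_integral_powr_atLeast: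
  fixes a p :: real
  assumes "a > 0" "p > 0"
  shows "(\<integral>\<^sup>+ t. ennreal (t powr (- p - 1)) * indicator {a..} t \<partial>lborel) = ennreal (a powr (- p) / p)"
proof -
  have "((\<lambda>t. t powr (- p - 1)) has_integral - (a powr (- p - 1 + 1)) / (- p - 1 + 1)) {a..}"
    using assms by (intro has_integral_powr_to_inf) auto
  then have "((\<lambda>t. t powr (- p - 1)) has_integral a powr (- p) / p) {a..}"
    by simp
  then show ?thesis
    by (intro nn_integral_has_integral_lebesgue') auto
qed

text \<open>Up to constants \<open>|1 - \<langle>z, a\<rangle>|\<close> is the maximum \<open>\<sigma>\<close> of \<open>1 - |a|\<close> and \<open>|1 - \<langle>z, e\<rangle>|\<close>, where \<open>e\<close> is the direction
of \<open>a\<close>. Write \<open>\<sigma>\<^bsup>-\<kappa>\<^esup>\<close> as \<open>\<kappa>\<close> times the integral of \<open>t\<^bsup>-\<kappa>-1\<^esup>\<close> over \<open>t \<ge> \<sigma>\<close> and exchange the integrals; the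
measures of the caps then lead to a convergent integral of \<open>t\<^bsup>m-\<kappa>-1\<^esup>\<close> over \<open>t \<ge> 1 - |a|\<close>.\<close>

lemma kernel_integral_le:
  fixes \<kappa> :: real
  assumes \<alpha>: "\<alpha> > -1" and \<kappa>: "\<kappa> > \<alpha> + real CARD('n) + 1"
  obtains C where "C > 0"
    "\<And>a :: complex ^ 'n. a \<in> ball 0 1 \<Longrightarrow>
      (\<integral>\<^sup>+ z. ennreal (norm (1 - herm z a) powr (- \<kappa>)) \<partial>bergman_measure \<alpha>)
        \<le> ennreal (C * (1 - norm a) powr (\<alpha> + real CARD('n) + 1 - \<kappa>))"
proof -
  define m where "m = \<alpha> + real CARD('n) + 1"
  have m: "m > 0" "\<kappa> > m"
    using \<alpha> \<kappa> by (auto simp: m_def)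
  obtain C0 where C0: "C0 > 0"
    "\<And>(e :: complex ^ 'n) \<tau>. norm e = 1 \<Longrightarrow> \<tau> > 0 \<Longrightarrow>
      emeasure (bergman_measure \<alpha>) (cap e \<tau>) \<le> ennreal (C0 * \<tau> powr (\<alpha> + real CARD('n) + 1))"
    by (rule emeasure_cap_le[OF \<alpha>, where 'n = 'n]) (rule that)
  define C where "C = 2 powr \<kappa> * \<kappa> * (C0 * 2 powr m) / (\<kappa> - m)"
  show thesis
  proof (rule that[of C], unfold m_def[symmetric])
    show "C > 0"
      using C0 m by (simp add: C_def)
    fix a :: "complex ^ 'n"
    assume a: "a \<in> ball 0 1"
    define \<delta> where "\<delta> = 1 - norm a"
    have \<delta>: "\<delta> > 0"
      using a by (simp add: \<delta>_def)
    obtain e where e: "norm e = 1" "a = norm a *\<^sub>R e"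
      by (rule obtain_direction)
    define V where "V = (bergman_measure \<alpha> :: (complex ^ 'n) measure)"
    interpret V: finite_measure V
      unfolding V_def by (rule finite_measure_bergman[OF \<alpha>])
    interpret pair_sigma_finite V lborel ..
    have idV: "(\<lambda>z. z) \<in> borel_measurable V"
      unfolding V_def by (rule measurable_bergman_ident)
    note [measurable] = idV measurable_compose[OF measurable_fst idV, of "lborel :: real measure"]
    (* caps are defined by a strict inequality, so 2 t in place of t makes room for |1 - <z,e>| = t *)
    define g where "g = (\<lambda>z (t :: real). (if norm (1 - herm z e) < 2 * t then ennreal 1 else 0) * (ennreal (t powr (- \<kappa> - 1)) * indicator {\<delta>..} t))"
    have gm: "case_prod g \<in> borel_measurable (V \<Otimes>\<^sub>M lborel)"
      unfolding g_def split_beta by measurable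
    have "(\<integral>\<^sup>+ z. ennreal (norm (1 - herm z a) powr (- \<kappa>)) \<partial>V)
      \<le> (\<integral>\<^sup>+ z. ennreal (2 powr \<kappa> * \<kappa>) * (\<integral>\<^sup>+ t. g z t \<partial>lborel) \<partial>V)"
    proof (rule nn_integral_mono)
      fix z
      assume "z \<in> space V"
      then have z: "z \<in> ball 0 1"
        by (simp add: V_def)
      define \<sigma> where "\<sigma> = max \<delta> (norm (1 - herm z e))"
      have \<sigma>: "\<sigma> > 0"
        using \<delta> by (simp add: \<sigma>_def)
      have 1: "\<delta> \<le> norm (1 - herm z a)"
      proof -
        have "norm z * norm a \<le> 1 * norm a"
          using z by (intro mult_right_mono) auto
        then have "norm (herm z a) \<le> norm a"
          using norm_herm_le[of z a] by simp
        moreover have "1 - norm (herm z a) \<le> norm (1 - herm z a)"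
          using norm_triangle_ineq2[of 1 "herm z a"] by simp
        ultimately show ?thesis
          by (simp add: \<delta>_def)
      qed
      have "norm (1 - herm z e) \<le> norm (1 - herm z a) + \<delta>"
        using one_minus_herm_le[OF z, of e a] dist_direction(1)[OF e] a by (simp add: \<delta>_def)
      then have "\<sigma> / 2 \<le> norm (1 - herm z a)"
        using 1 \<delta> by (auto simp: \<sigma>_def max_def)
      then have "norm (1 - herm z a) powr (- \<kappa>) \<le> (\<sigma> / 2) powr (- \<kappa>)"
        using \<sigma> m by (intro powr_mono2') auto
      also have "\<dots> = \<sigma> powr (- \<kappa>) / 2 powr (- \<kappa>)"
        by (rule powr_divide)
      also have "\<dots> = (2 powr \<kappa> * \<kappa>) * (\<sigma> powr (- \<kappa>) / \<kappa>)"
        using m by (simp add: powr_minus field_simps)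
      finally have "ennreal (norm (1 - herm z a) powr (- \<kappa>)) \<le> ennreal ((2 powr \<kappa> * \<kappa>) * (\<sigma> powr (- \<kappa>) / \<kappa>))"
        by (rule ennreal_leI)
      also have "\<dots> = ennreal (2 powr \<kappa> * \<kappa>) * ennreal (\<sigma> powr (- \<kappa>) / \<kappa>)"
        using m by (intro ennreal_mult) auto
      also have "ennreal (\<sigma> powr (- \<kappa>) / \<kappa>) = (\<integral>\<^sup>+ t. ennreal (t powr (- \<kappa> - 1)) * indicator {\<sigma>..} t \<partial>lborel)"
        by (rule nn_integral_powr_atLeast[symmetric]) (use \<sigma> m in auto)
      also have "\<dots> \<le> (\<integral>\<^sup>+ t. g z t \<partial>lborel)"
      proof (rule nn_integral_mono)
        fix t :: real
        show "ennreal (t powr (- \<kappa> - 1)) * indicator {\<sigma>..} t \<le> g z t"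
          using \<delta> by (auto simp: g_def \<sigma>_def indicator_def)
      qed
      finally show "ennreal (norm (1 - herm z a) powr (- \<kappa>)) \<le> ennreal (2 powr \<kappa> * \<kappa>) * (\<integral>\<^sup>+ t. g z t \<partial>lborel)"
        by (simp add: mult_left_mono)
    qed
    also have "\<dots> = ennreal (2 powr \<kappa> * \<kappa>) * (\<integral>\<^sup>+ z. (\<integral>\<^sup>+ t. g z t \<partial>lborel) \<partial>V)"
      by (rule nn_integral_cmult) (rule lborel.borel_measurable_nn_integral[OF gm])
    also have "(\<integral>\<^sup>+ z. (\<integral>\<^sup>+ t. g z t \<partial>lborel) \<partial>V) = (\<integral>\<^sup>+ t. (\<integral>\<^sup>+ z. g z t \<partial>V) \<partial>lborel)"
      by (rule Fubini'[OF gm, symmetric])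
    also have "\<dots> \<le> (\<integral>\<^sup>+ t. ennreal (C0 * 2 powr m) * (ennreal (t powr (- (\<kappa> - m) - 1)) * indicator {\<delta>..} t) \<partial>lborel)"
    proof (rule nn_integral_mono)
      fix t :: real
      show "(\<integral>\<^sup>+ z. g z t \<partial>V) \<le> ennreal (C0 * 2 powr m) * (ennreal (t powr (- (\<kappa> - m) - 1)) * indicator {\<delta>..} t)"
      proof (cases "t \<ge> \<delta>")
        case True
        then have t: "t > 0"
          using \<delta> by simp
        have "(\<integral>\<^sup>+ z. g z t \<partial>V) = (\<integral>\<^sup>+ z. (if norm (1 - herm z e) < 2 * t then ennreal 1 else 0) \<partial>V) * ennreal (t powr (- \<kappa> - 1))"
          using True unfolding g_def by (subst nn_integral_multc) auto
        also have "(\<integral>\<^sup>+ z. (if norm (1 - herm z e) < 2 * t then ennreal 1 else 0) \<partial>V) = (\<integral>\<^sup>+ z. indicator (cap e (2 * t)) z \<partial>V)"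
          by (intro nn_integral_cong) (auto simp: V_def cap_def indicator_def)
        also have "\<dots> = emeasure V (cap e (2 * t))"
          unfolding V_def by (intro nn_integral_indicator borel_subset_in_sets_bergman borel_cap cap_subset_ball)
        also have "\<dots> \<le> ennreal (C0 * (2 * t) powr m)"
          using C0(2)[OF e(1), of "2 * t"] t by (simp add: V_def m_def)
        also have "(2 * t) powr m = 2 powr m * t powr m"
          by (rule powr_mult)
        also have "ennreal (C0 * (2 powr m * t powr m)) * ennreal (t powr (- \<kappa> - 1))
          = ennreal (C0 * 2 powr m) * ennreal (t powr (- (\<kappa> - m) - 1))"
        proof -
          have "t powr m * t powr (- \<kappa> - 1) = t powr (- (\<kappa> - m) - 1)"
            by (simp add: algebra_simps flip: powr_add)
          then show ?thesis
            using C0(1) by (simp add: mult.assoc flip: ennreal_mult)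
        qed
        finally show ?thesis
          using True by (simp add: mult_right_mono)
      qed (simp add: g_def)
    qed
    also have "\<dots> = ennreal (C0 * 2 powr m) * ennreal (\<delta> powr (- (\<kappa> - m)) / (\<kappa> - m))"
      using \<delta> m nn_integral_powr_atLeast[of \<delta> "\<kappa> - m"] by (subst nn_integral_cmult) auto
    also have "ennreal (2 powr \<kappa> * \<kappa>) * (ennreal (C0 * 2 powr m) * ennreal (\<delta> powr (- (\<kappa> - m)) / (\<kappa> - m)))
      = ennreal (C * \<delta> powr (m - \<kappa>))"
      using m C0(1) by (simp add: C_def flip: ennreal_mult)
    finally show "(\<integral>\<^sup>+ z. ennreal (norm (1 - herm z a) powr (- \<kappa>)) \<partial>bergman_measure \<alpha>)
        \<le> ennreal (C * (1 - norm a) powr (m - \<kappa>))"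
      by (simp add: V_def \<delta>_def mult_left_mono)
  qed
qed

section \<open>Carleson tents\<close>

lemma carleson_tent_eq_cap:
  "z \<noteq> 0 \<Longrightarrow> carleson_tent z = cap (z /\<^sub>R norm z) (1 - norm z)"
proof -
  assume "z \<noteq> 0"
  have "norm (1 - herm (z /\<^sub>R norm z) w) = norm (1 - herm w (z /\<^sub>R norm z))" for w
    using complex_mod_cnj[of "1 - herm w (z /\<^sub>R norm z)"] by (simp add: herm_commute[of "z /\<^sub>R norm z"])
  then show ?thesis
    using \<open>z \<noteq> 0\<close> by (auto simp: carleson_tent_def cap_def)
qed

lemma borel_carleson_tent: "carleson_tent z \<in> sets borel"
  by (cases "z = 0") (auto simp: carleson_tent_eq_cap carleson_tent_def[of 0])

lemma carleson_tent_subset_ball: "carleson_tent z \<subseteq> ball 0 1"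
  by (auto simp: carleson_tent_def)

lemma carleson_tent_kernel_le:
  assumes a: "a \<in> ball 0 1" and w: "w \<in> carleson_tent a"
  shows "norm (1 - herm w a) \<le> 2 * (1 - norm a)"
proof (cases "a = 0")
  case False
  define e where "e = a /\<^sub>R norm a"
  have e: "norm e = 1" "a = norm a *\<^sub>R e"
    using False by (auto simp: e_def)
  have "norm (1 - herm w e) < 1 - norm a" "w \<in> ball 0 1"
    using w False by (auto simp: carleson_tent_eq_cap cap_def e_def)
  then show ?thesis
    using one_minus_herm_le[of w a e] dist_direction(2)[OF e] a by simp
qed simp

text \<open>The point \<open>w\<close> is moved from \<open>a\<close> towards the boundary so that its kernel neighbourhood, of size
\<open>3 (1 - |w|) = (1 - |a|) / 2\<close>, fits into the tent together with the error \<open>1 - |w|\<close> of replacing \<open>w\<close> by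
its direction \<open>e\<close>. For \<open>a = 0\<close> the tent is the whole ball and any direction will do.\<close>

lemma kernel_nbhd_subset_carleson_tent:
  fixes a :: "complex ^ 'n"
  assumes a: "a \<in> ball 0 1"
  obtains w where "w \<in> ball 0 1" "1 - norm w = (1 - norm a) / 6" "kernel_nbhd w \<subseteq> carleson_tent a"
proof -
  obtain e where e: "norm e = 1" "a = norm a *\<^sub>R e"
    by (rule obtain_direction)
  define d where "d = 1 - norm a"
  have d: "0 < d" "d \<le> 1"
    using a by (auto simp: d_def)
  define w where "w = (1 - d / 6) *\<^sub>R e"
  have nw: "norm w = 1 - d / 6"
    using e d by (simp add: w_def)
  have we: "norm e = 1" "w = norm w *\<^sub>R e"
    using e nw by (simp_all add: w_def)
  show thesis
  proof (rule that[of w])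
    show "w \<in> ball 0 1"
      using nw d by simp
    show "1 - norm w = (1 - norm a) / 6"
      using nw by (simp add: d_def)
    show "kernel_nbhd w \<subseteq> carleson_tent a"
    proof
      fix z
      assume "z \<in> kernel_nbhd w"
      then have z: "z \<in> ball 0 1" "norm (1 - herm z w) \<le> d / 2"
        by (auto simp: kernel_nbhd_def nw)
      have "norm (1 - herm z e) \<le> d / 2 + d / 6"
        using one_minus_herm_le[OF z(1), of e w] dist_direction(1)[OF we] z(2) nw d by simp
      then have "z \<in> cap e (1 - norm a)"
        using z(1) d by (simp add: cap_def d_def)
      moreover have "e = a /\<^sub>R norm a" if "a \<noteq> 0"
        using that by (subst (2) e(2)) simp
      ultimately show "z \<in> carleson_tent a"
        using z(1) by (cases "a = 0") (auto simp: carleson_tent_eq_cap carleson_tent_def[of 0])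
    qed
  qed
qed

lemma emeasure_carleson_tent_ge:
  assumes \<alpha>: "\<alpha> > -1"
  obtains c where "c > 0"
    "\<And>a :: complex ^ 'n. a \<in> ball 0 1 \<Longrightarrow>
      ennreal (c * (1 - norm a) powr (\<alpha> + real CARD('n) + 1)) \<le> emeasure (bergman_measure \<alpha>) (carleson_tent a)"
proof -
  define m where "m = \<alpha> + real CARD('n) + 1"
  obtain c where c: "c > 0"
    "\<And>w :: complex ^ 'n. w \<in> ball 0 1 \<Longrightarrow>
      ennreal (c * (1 - norm w) powr (\<alpha> + real CARD('n) + 1)) \<le> emeasure (bergman_measure \<alpha>) (kernel_nbhd w)"
    by (rule emeasure_kernel_nbhd_ge[OF \<alpha>, where 'n = 'n]) (rule that)
  show thesis
  proof (rule that[of "c / 6 powr m"], unfold m_def[symmetric])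
    show "c / 6 powr m > 0"
      using c by simp
    fix a :: "complex ^ 'n"
    assume "a \<in> ball 0 1"
    then obtain w where w: "w \<in> ball 0 1" "1 - norm w = (1 - norm a) / 6" "kernel_nbhd w \<subseteq> carleson_tent a"
      by (rule kernel_nbhd_subset_carleson_tent)
    have "((1 - norm a) / 6) powr m = (1 - norm a) powr m / 6 powr m"
      by (rule powr_divide)
    then have "ennreal (c / 6 powr m * (1 - norm a) powr m) = ennreal (c * (1 - norm w) powr m)"
      by (simp add: w(2))
    also have "\<dots> \<le> emeasure (bergman_measure \<alpha>) (kernel_nbhd w)"
      unfolding m_def by (rule c(2)[OF w(1)])
    also have "\<dots> \<le> emeasure (bergman_measure \<alpha>) (carleson_tent a)"
      by (intro emeasure_mono w borel_subset_in_sets_bergman borel_carleson_tent carleson_tent_subset_ball)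
    finally show "ennreal (c / 6 powr m * (1 - norm a) powr m) \<le> emeasure (bergman_measure \<alpha>) (carleson_tent a)" .
  qed
qed

text \<open>The test function \<open>(1 - \<langle>z, a\<rangle>)\<^bsup>-N\<^esup>\<close> has modulus at least \<open>(2 (1 - |a|))\<^bsup>-N\<^esup>\<close> on the tent over \<open>a\<close>,
while the integral of its \<open>q\<close>-th power over the ball is of order \<open>(1 - |a|)\<^bsup>m-Nq\<^esup>\<close>. Hence the measure of
the tent is at most of order \<open>(1 - |a|)\<^sup>m\<close>, which is the order of its \<open>V\<^sub>\<alpha>\<close>-measure.\<close>

lemma carleson_measureI_embedding:
  fixes \<mu> :: "(complex ^ 'n) measure"
  assumes \<alpha>: "\<alpha> > -1" and q: "q > 1"
    and \<mu>: "sets \<mu> = sets (restrict_space borel (ball 0 1))"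
    and B: "B < \<infinity>"
    and emb: "\<And>f. f \<in> bergman_space \<alpha> q \<Longrightarrow>
      (\<integral>\<^sup>+ w. ennreal (norm (f w) powr q) \<partial>\<mu>) \<le> B * (\<integral>\<^sup>+ z. ennreal (norm (f z) powr q) \<partial>bergman_measure \<alpha>)"
  shows "carleson_measure \<alpha> \<mu>"
proof -
  define m where "m = \<alpha> + real CARD('n) + 1"
  obtain N :: nat where "m / q < real N"
    using reals_Archimedean2 by blast
  define \<kappa> where "\<kappa> = real N * q"
  have \<kappa>: "\<kappa> > m" "\<kappa> > \<alpha> + real CARD('n) + 1"
    using \<open>m / q < real N\<close> q by (simp_all add: \<kappa>_def m_def field_simps)
  obtain C where C: "C > 0"
    "\<And>a :: complex ^ 'n. a \<in> ball 0 1 \<Longrightarrow>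
      (\<integral>\<^sup>+ z. ennreal (norm (1 - herm z a) powr (- \<kappa>)) \<partial>bergman_measure \<alpha>)
        \<le> ennreal (C * (1 - norm a) powr (\<alpha> + real CARD('n) + 1 - \<kappa>))"
    by (rule kernel_integral_le[OF \<alpha> \<kappa>(2)]) (rule that)
  obtain c where c: "c > 0"
    "\<And>a :: complex ^ 'n. a \<in> ball 0 1 \<Longrightarrow>
      ennreal (c * (1 - norm a) powr (\<alpha> + real CARD('n) + 1)) \<le> emeasure (bergman_measure \<alpha>) (carleson_tent a)"
    by (rule emeasure_carleson_tent_ge[OF \<alpha>, where 'n = 'n]) (rule that)
  define R where "R = ennreal (2 powr \<kappa>) * (B * ennreal (C / c))"
  have R: "R < \<infinity>"
    using B by (simp add: R_def ennreal_mult_less_top)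
  have ratio: "emeasure \<mu> (carleson_tent a) / emeasure (bergman_measure \<alpha>) (carleson_tent a) \<le> R"
    if a: "a \<in> ball 0 1" for a
  proof -
    define \<delta> where "\<delta> = 1 - norm a"
    have \<delta>: "\<delta> > 0"
      using a by (simp add: \<delta>_def)
    define T where "T = carleson_tent a"
    have T: "T \<in> sets \<mu>"
      unfolding \<mu> T_def using borel_carleson_tent[of a] carleson_tent_subset_ball[of a]
      by (simp add: sets_restrict_space_iff)
    define f where "f = (\<lambda>z. inverse (1 - herm z a) ^ N)"
    have fh: "holo_on f (ball 0 1)"
      unfolding f_def by (rule holo_on_kernel_power[OF a])
    have fq: "norm (f z) powr q = norm (1 - herm z a) powr (- \<kappa>)" if z: "z \<in> ball 0 1" for z
    proof -
      have "norm (1 - herm z a) > 0"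
        by (rule norm_one_minus_herm_pos[OF z a])
      then have "norm (f z) = norm (1 - herm z a) powr (- real N)"
        by (simp add: f_def norm_power norm_inverse powr_minus powr_realpow power_inverse)
      then show ?thesis
        by (simp add: powr_powr \<kappa>_def)
    qed
    have If: "(\<integral>\<^sup>+ z. ennreal (norm (f z) powr q) \<partial>bergman_measure \<alpha>) \<le> ennreal (C * \<delta> powr (m - \<kappa>))"
    proof -
      have "(\<integral>\<^sup>+ z. ennreal (norm (f z) powr q) \<partial>bergman_measure \<alpha>)
        = (\<integral>\<^sup>+ z. ennreal (norm (1 - herm z a) powr (- \<kappa>)) \<partial>bergman_measure \<alpha>)"
        by (intro nn_integral_cong) (simp add: fq)
      then show ?thesis
        using C(2)[OF a] by (simp add: \<delta>_def m_def)
    qed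
    have "f \<in> bergman_space \<alpha> q"
      unfolding bergman_space_def
    proof (intro CollectI conjI fh integrableI_bounded)
      have "f \<in> borel_measurable (bergman_measure \<alpha>)"
        by (rule measurable_restrict_imp_bergman[OF holo_measurable_restrict[OF fh]])
      then show "(\<lambda>z. norm (f z) powr q) \<in> borel_measurable (bergman_measure \<alpha>)"
        by measurable
      show "(\<integral>\<^sup>+ z. ennreal (norm (norm (f z) powr q)) \<partial>bergman_measure \<alpha>) < \<infinity>"
        using If by (simp add: le_less_trans)
    qed
    note embf = emb[OF this]
    have "ennreal ((2 * \<delta>) powr (- \<kappa>)) * emeasure \<mu> T = (\<integral>\<^sup>+ w. ennreal ((2 * \<delta>) powr (- \<kappa>)) * indicator T w \<partial>\<mu>)"
      using T by (simp add: nn_integral_cmult_indicator)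
    also have "\<dots> \<le> (\<integral>\<^sup>+ w. ennreal (norm (f w) powr q) \<partial>\<mu>)"
    proof (rule nn_integral_mono)
      fix w
      show "ennreal ((2 * \<delta>) powr (- \<kappa>)) * indicator T w \<le> ennreal (norm (f w) powr q)"
      proof (cases "w \<in> T")
        case True
        then have w: "w \<in> ball 0 1"
          using carleson_tent_subset_ball[of a] by (auto simp: T_def)
        have "(2 * \<delta>) powr (- \<kappa>) \<le> norm (1 - herm w a) powr (- \<kappa>)"
        proof (rule powr_mono2')
          show "- \<kappa> \<le> 0"
            using q by (simp add: \<kappa>_def)
          show "norm (1 - herm w a) > 0"
            by (rule norm_one_minus_herm_pos[OF w a])
          show "norm (1 - herm w a) \<le> 2 * \<delta>"
            using carleson_tent_kernel_le[OF a] True by (simp add: T_def \<delta>_def)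
        qed
        then show ?thesis
          using True by (simp add: fq[OF w] ennreal_leI)
      qed simp
    qed
    also have "\<dots> \<le> B * ennreal (C * \<delta> powr (m - \<kappa>))"
      using embf by (rule order_trans) (intro mult_left_mono If, simp)
    finally have "ennreal ((2 * \<delta>) powr \<kappa>) * (ennreal ((2 * \<delta>) powr (- \<kappa>)) * emeasure \<mu> T)
      \<le> ennreal ((2 * \<delta>) powr \<kappa>) * (B * ennreal (C * \<delta> powr (m - \<kappa>)))"
      by (rule mult_left_mono) simp
    also have "ennreal ((2 * \<delta>) powr \<kappa>) * (ennreal ((2 * \<delta>) powr (- \<kappa>)) * emeasure \<mu> T) = emeasure \<mu> T"
    proof -
      have "ennreal ((2 * \<delta>) powr \<kappa>) * ennreal ((2 * \<delta>) powr (- \<kappa>)) = 1"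
        using \<delta> by (simp flip: ennreal_mult powr_add)
      then show ?thesis
        by (simp flip: mult.assoc)
    qed
    also have "ennreal ((2 * \<delta>) powr \<kappa>) * (B * ennreal (C * \<delta> powr (m - \<kappa>)))
      = R * ennreal (c * \<delta> powr m)"
    proof -
      have "\<delta> powr \<kappa> * \<delta> powr (m - \<kappa>) = \<delta> powr m"
        by (simp flip: powr_add)
      then have "(2 * \<delta>) powr \<kappa> * (C * \<delta> powr (m - \<kappa>)) = (2 powr \<kappa> * (C / c)) * (c * \<delta> powr m)"
        using c(1) by (simp add: powr_mult mult_ac)
      then have "ennreal ((2 * \<delta>) powr \<kappa>) * ennreal (C * \<delta> powr (m - \<kappa>))
        = (ennreal (2 powr \<kappa>) * ennreal (C / c)) * ennreal (c * \<delta> powr m)"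
        using C(1) c(1) by (simp flip: ennreal_mult)
      then have "B * (ennreal ((2 * \<delta>) powr \<kappa>) * ennreal (C * \<delta> powr (m - \<kappa>)))
        = B * ((ennreal (2 powr \<kappa>) * ennreal (C / c)) * ennreal (c * \<delta> powr m))"
        by (simp only:)
      then show ?thesis
        unfolding R_def by (simp only: mult_ac)
    qed
    also have "R * ennreal (c * \<delta> powr m) \<le> R * emeasure (bergman_measure \<alpha>) T"
      unfolding T_def m_def \<delta>_def by (intro mult_left_mono c(2)[OF a]) simp
    finally have le: "emeasure \<mu> T \<le> R * emeasure (bergman_measure \<alpha>) T" .
    have "0 < ennreal (c * \<delta> powr m)"
      using c(1) \<delta> by simp
    also have "\<dots> \<le> emeasure (bergman_measure \<alpha>) T"
      unfolding T_def m_def \<delta>_def by (rule c(2)[OF a])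
    finally have "emeasure (bergman_measure \<alpha>) T > 0" .
    then show ?thesis
      unfolding T_def[symmetric] using le
      by (intro divide_le_posI_ennreal) (simp_all add: mult.commute)
  qed
  have "(SUP z\<in>ball 0 1. emeasure \<mu> (carleson_tent z) / emeasure (bergman_measure \<alpha>) (carleson_tent z)) \<le> R"
    by (rule SUP_least[OF ratio])
  then show ?thesis
    unfolding carleson_measure_def using \<mu> R by (auto intro: le_less_trans)
qed

theorem theorem5p9:
  fixes q s \<alpha> :: real
    and u :: "complex ^ 'n \<Rightarrow> complex"
    and \<phi> :: "complex ^ 'n \<Rightarrow> complex ^ 'n"
  assumes "q > 1" and "1 < s" and "s < conj_exponent q" and "\<alpha> > -1"
    and "holo_on u (ball 0 1)"
    and "holo_self_map \<phi>"
    and "bergman_bounded \<alpha> q (weighted_comp u \<phi>)"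
  shows "(\<exists>C>0. \<forall>\<omega>. weight \<omega> \<and> (\<lambda>z. \<omega> z powr conj_exponent s) \<in> weight_class \<alpha> q u \<phi> \<longrightarrow>
            (\<forall>f\<in>bergman_space \<alpha> q.
               (\<integral>\<^sup>+ z. ennreal (norm (u z) powr q * norm (f (\<phi> z)) powr q * \<omega> z)
                  \<partial>bergman_measure \<alpha>)
               \<le> ennreal (C * enn2real (weight_const \<alpha> q u \<phi> (\<lambda>z. \<omega> z powr conj_exponent s))
                    powr (1 / conj_exponent s) * bergman_norm \<alpha> q f powr q))) \<and>
         (\<forall>\<omega>. weight \<omega> \<and> (\<lambda>z. \<omega> z powr conj_exponent s) \<in> weight_class \<alpha> q u \<phi> \<longrightarrow>
            carleson_measure \<alpha> (pushforward_measure u \<phi> q \<omega> \<alpha>))"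
proof -
  define s' where "s' = conj_exponent s"
  have s': "s' > 1"
    using \<open>1 < s\<close> by (simp add: s'_def conj_exponent_def)
  obtain C where C: "C > 0"
    "\<And>\<omega> f. \<lbrakk>weight \<omega>; (\<lambda>z. \<omega> z powr s') \<in> weight_class \<alpha> q u \<phi>; f \<in> bergman_space \<alpha> q\<rbrakk> \<Longrightarrow>
      (\<integral>\<^sup>+ z. ennreal (norm (u z) powr q * norm (f (\<phi> z)) powr q * \<omega> z) \<partial>bergman_measure \<alpha>)
        \<le> ennreal (C * enn2real (weight_const \<alpha> q u \<phi> (\<lambda>z. \<omega> z powr s')) powr (1 / s')
            * bergman_norm \<alpha> q f powr q)"
    by (rule weighted_integral_le[OF \<open>\<alpha> > -1\<close> \<open>q > 1\<close> s' assms(5-7)]) (rule that)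
  have "carleson_measure \<alpha> (pushforward_measure u \<phi> q \<omega> \<alpha>)"
    if \<omega>: "weight \<omega>" "(\<lambda>z. \<omega> z powr s') \<in> weight_class \<alpha> q u \<phi>" for \<omega>
  proof (rule carleson_measureI_embedding[OF \<open>\<alpha> > -1\<close> \<open>q > 1\<close>])
    define D where "D = C * enn2real (weight_const \<alpha> q u \<phi> (\<lambda>z. \<omega> z powr s')) powr (1 / s')"
    show "sets (pushforward_measure u \<phi> q \<omega> \<alpha>) = sets (restrict_space borel (ball 0 1))"
      by (simp add: pushforward_measure_def)
    show "ennreal D < \<infinity>"
      by simp
    fix f :: "complex ^ 'n \<Rightarrow> complex"
    assume f: "f \<in> bergman_space \<alpha> q"
    then have "f \<in> borel_measurable (restrict_space borel (ball 0 1))"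
      by (intro holo_measurable_restrict) (simp add: bergman_space_def)
    then have fm: "(\<lambda>w. ennreal (norm (f w) powr q)) \<in> borel_measurable (restrict_space borel (ball 0 1))"
      by measurable
    have "(\<integral>\<^sup>+ w. ennreal (norm (f w) powr q) \<partial>pushforward_measure u \<phi> q \<omega> \<alpha>)
      = (\<integral>\<^sup>+ z. ennreal (norm (u z) powr q * norm (f (\<phi> z)) powr q * \<omega> z) \<partial>bergman_measure \<alpha>)"
      unfolding nn_integral_pushforward_measure[OF assms(5,6) \<omega>(1) fm]
      using \<omega>(1) by (intro nn_integral_cong) (auto simp: weight_def ennreal_mult)
    also have "\<dots> \<le> ennreal (D * bergman_norm \<alpha> q f powr q)"
      unfolding D_def by (rule C(2)[OF \<omega> f])
    also have "\<dots> = ennreal D * (\<integral>\<^sup>+ z. ennreal (norm (f z) powr q) \<partial>bergman_measure \<alpha>)"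
      using C(1) by (simp add: D_def ennreal_mult flip: bergman_norm_powr[OF f \<open>q > 1\<close>])
    finally show "(\<integral>\<^sup>+ w. ennreal (norm (f w) powr q) \<partial>pushforward_measure u \<phi> q \<omega> \<alpha>)
      \<le> ennreal D * (\<integral>\<^sup>+ z. ennreal (norm (f z) powr q) \<partial>bergman_measure \<alpha>)" .
  qed
  then show ?thesis
    using C unfolding s'_def[symmetric] by blast
qed

end
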